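(* Suppose that the random measure $G$ satisfies the Ghirlanda-Guerra identities. Let $r\geq 1$, let $1\leq n_1<n_2<\ldots<n_r$ be integers, $n_0=0$, and $I_p=\{n_{p-1}+1,\ldots,n_p\}$ for $p\leq r$. For each $p\leq r$ and $l\in I_p$ let $f_l(R^{I_p},x)$ be a bounded measurable real-valued function of $R^{I_p}$ and $x\in\mathbb{R}$, and let $Z^1,\ldots,Z^r$ be defined from these functions as in the context. Then for every bounded measurable function $\Phi$ of $R^{I_r}$, $$ \mathbb{E}\langle\Phi\rangle=\mathbb{E}\langle Z^1\cdots Z^r\,\Phi\rangle . $$
   Context: $G$ is a random probability measure on the unit ball of a separable Hilbert space $H$; $(\sigma^l)_{l\geq 1}$ is an i.i.d. sequence from $G$; $\langle\cdot\rangle$ is the average with respect to $G^{\otimes\infty}$; $\mathbb{E}$ is the expectation with respect to the randomness of $G$. $R_{l,l'}=\sigma^l\cdot\sigma^{l'}$ is the scalar product (overlap), and $\mu$ is the law of $R_{1,2}$ under $\mathbb{E}G^{\otimes 2}$. Ghirlanda-Guerra identities: for any $n\geq 2$, any bounded measurable function $f$ of the overlaps $(R_{l,l'})_{l,l'\leq n}$ and any bounded measurable function $\psi$ of one overlap, $$\mathbb{E}\langle f\psi(R_{1,n+1})\rangle=\frac1n\,\mathbb{E}\langle f\rangle\,\mathbb{E}\langle\psi(R_{1,2})\rangle+\frac1n\sum_{l=2}^n\mathbb{E}\langle f\psi(R_{1,l})\rangle .$$ Definitions: $R^{I_p}=(R_{l,l'})_{l<l',\,l,l'\in I_p}$. For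 $l\in I_p$ write $f_l(x)=f_l(R^{I_p},x)$, keeping the dependence on $R^{I_p}$ implicit. For $p\leq r$, $$F^p(\sigma,\sigma^1,\ldots,\sigma^{n_p})=f_1(\sigma\cdot\sigma^1)+\ldots+f_{n_p}(\sigma\cdot\sigma^{n_p}),$$ for $l\in I_p$, $$F_l^p(\sigma,\sigma^1,\ldots,\sigma^{n_p})=F^p(\sigma,\sigma^1,\ldots,\sigma^{n_p})-f_l(R^{I_p},\sigma\cdot\sigma^l)+\int f_l(R^{I_p},x)\,d\mu(x),$$ and $$Z^p=Z^p(\sigma^1,\ldots,\sigma^{n_p})=\frac{\exp\sum_{l\in I_p}F_l^p(\sigma^l,\sigma^1,\ldots,\sigma^{n_p})}{\langle\exp F^p(\sigma,\sigma^1,\ldots,\sigma^{n_p})\rangle_{-}^{|I_p|}},$$ where $\langle\cdot\rangle_{-}$ denotes the average with respect to $G$ in $\sigma$ only, for fixed $\sigma^1,\ldots,\sigma^{n_p}$. *)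

theory Defs
  imports "HOL-Probability.Probability"
begin

definition bounded_measurable :: "'a measure \<Rightarrow> ('a \<Rightarrow> real) \<Rightarrow> bool" where
  "bounded_measurable N g \<longleftrightarrow> g \<in> borel_measurable N \<and> bounded (g ` space N)"

(* "Unit ball" is read as the closed ball, which covers measures on the open ball as well.
   A separable Hilbert space is a type of the three classes below. *)
definition random_measure_on_unit_ball ::
  "'w measure \<Rightarrow> ('w \<Rightarrow> 'h::{real_inner, complete_space, second_countable_topology} measure) \<Rightarrow> bool" where
  "random_measure_on_unit_ball M G \<longleftrightarrow>
     prob_space M \<and> G \<in> measurable M (prob_algebra borel) \<and>
     (\<forall>\<omega>\<in>space M. emeasure (G \<omega>) (cball 0 1) = 1)"

(* The integrand may depend on omega besides the replicas, because it may involve G itself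
   (as Z below does). *)
definition E_avg ::
  "'w measure \<Rightarrow> ('w \<Rightarrow> 'h measure) \<Rightarrow> ('w \<Rightarrow> (nat \<Rightarrow> 'h) \<Rightarrow> real) \<Rightarrow> real" where
  "E_avg M G g = (\<integral>\<omega>. (\<integral>\<sigma>. g \<omega> \<sigma> \<partial>(\<Pi>\<^sub>M l\<in>{1..}. G \<omega>)) \<partial>M)"

(* The overlaps with index pairs in A, as a point of the product space over A. *)
definition overlaps ::
  "(nat \<times> nat) set \<Rightarrow> (nat \<Rightarrow> 'h::real_inner) \<Rightarrow> nat \<times> nat \<Rightarrow> real" where
  "overlaps A \<sigma> = (\<lambda>(l, l')\<in>A. \<sigma> l \<bullet> \<sigma> l')"

definition pairs :: "nat set \<Rightarrow> (nat \<times> nat) set" where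
  "pairs I = {(l, l'). l \<in> I \<and> l' \<in> I \<and> l < l'}"

definition overlap_law ::
  "'w measure \<Rightarrow> ('w \<Rightarrow> 'h::{real_inner, complete_space, second_countable_topology} measure)
    \<Rightarrow> real measure" where
  "overlap_law M G = distr (M \<bind> (\<lambda>\<omega>. G \<omega> \<Otimes>\<^sub>M G \<omega>)) borel (\<lambda>(x, y). x \<bullet> y)"

(* Here f may depend on all overlaps, the self-overlaps R_{l,l} included. *)
definition ghirlanda_guerra ::
  "'w measure \<Rightarrow> ('w \<Rightarrow> 'h::{real_inner, complete_space, second_countable_topology} measure) \<Rightarrow> bool" where
  "ghirlanda_guerra M G \<longleftrightarrow>
     (\<forall>n f \<psi>. n \<ge> 2 \<longrightarrow>
        bounded_measurable (\<Pi>\<^sub>M a\<in>{1..n} \<times> {1..n}. borel) f \<longrightarrow>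
        bounded_measurable borel \<psi> \<longrightarrow>
        E_avg M G (\<lambda>\<omega> \<sigma>. f (overlaps ({1..n} \<times> {1..n}) \<sigma>) * \<psi> (\<sigma> 1 \<bullet> \<sigma> (n + 1)))
        = 1 / real n * E_avg M G (\<lambda>\<omega> \<sigma>. f (overlaps ({1..n} \<times> {1..n}) \<sigma>))
              * E_avg M G (\<lambda>\<omega> \<sigma>. \<psi> (\<sigma> 1 \<bullet> \<sigma> 2))
          + 1 / real n *
              (\<Sum>l = 2..n. E_avg M G
                 (\<lambda>\<omega> \<sigma>. f (overlaps ({1..n} \<times> {1..n}) \<sigma>) * \<psi> (\<sigma> 1 \<bullet> \<sigma> l))))"

definition block :: "(nat \<Rightarrow> nat) \<Rightarrow> nat \<Rightarrow> nat set" where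
  "block n p = {n (p - 1) + 1..n p}"

definition block_overlaps ::
  "(nat \<Rightarrow> nat) \<Rightarrow> nat \<Rightarrow> (nat \<Rightarrow> 'h::real_inner) \<Rightarrow> nat \<times> nat \<Rightarrow> real" where
  "block_overlaps n p \<sigma> = overlaps (pairs (block n p)) \<sigma>"

abbreviation block_space :: "(nat \<Rightarrow> nat) \<Rightarrow> nat \<Rightarrow> (nat \<times> nat \<Rightarrow> real) measure" where
  "block_space n p \<equiv> \<Pi>\<^sub>M a\<in>pairs (block n p). borel"

(* The sum over l = 1, ..., n_p, grouped by blocks: in each term, f_l takes the overlaps of
   the block q that contains l. *)
definition F ::
  "(nat \<Rightarrow> nat) \<Rightarrow> (nat \<Rightarrow> (nat \<times> nat \<Rightarrow> real) \<Rightarrow> real \<Rightarrow> real) \<Rightarrow> nat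
    \<Rightarrow> 'h::real_inner \<Rightarrow> (nat \<Rightarrow> 'h) \<Rightarrow> real" where
  "F n f p s \<sigma> = (\<Sum>q = 1..p. \<Sum>l\<in>block n q. f l (block_overlaps n q \<sigma>) (s \<bullet> \<sigma> l))"

definition F_at ::
  "real measure \<Rightarrow> (nat \<Rightarrow> nat) \<Rightarrow> (nat \<Rightarrow> (nat \<times> nat \<Rightarrow> real) \<Rightarrow> real \<Rightarrow> real) \<Rightarrow> nat \<Rightarrow> nat
    \<Rightarrow> 'h::real_inner \<Rightarrow> (nat \<Rightarrow> 'h) \<Rightarrow> real" where
  "F_at \<mu> n f p l s \<sigma> =
     F n f p s \<sigma> - f l (block_overlaps n p \<sigma>) (s \<bullet> \<sigma> l)
       + (\<integral>x. f l (block_overlaps n p \<sigma>) x \<partial>\<mu>)"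

definition Z ::
  "'w measure \<Rightarrow> ('w \<Rightarrow> 'h::{real_inner, complete_space, second_countable_topology} measure)
    \<Rightarrow> (nat \<Rightarrow> nat) \<Rightarrow> (nat \<Rightarrow> (nat \<times> nat \<Rightarrow> real) \<Rightarrow> real \<Rightarrow> real) \<Rightarrow> nat
    \<Rightarrow> 'w \<Rightarrow> (nat \<Rightarrow> 'h) \<Rightarrow> real" where
  "Z M G n f p \<omega> \<sigma> =
     exp (\<Sum>l\<in>block n p. F_at (overlap_law M G) n f p l (\<sigma> l) \<sigma>)
       / (\<integral>s. exp (F n f p s \<sigma>) \<partial>G \<omega>) ^ card (block n p)"

end

theory Submission
  imports Defs
begin

text \<open>
  The theorem says that changes of density of a special form do not affect the law of the overlaps.
  The blocks are added one at a time. Once the first p of them have been processed, the product of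
  Z^1, ..., Z^p is a probability density for the randomness together with the replicas in these blocks,
  and conditionally on all of this later replicas are sampled from the random measure tilted by the
  exponential of F^p. The statement carried by the induction (locale \<open>tilted_system\<close>) is
  that under this change the overlaps of the later replicas have the same law as originally. In
  particular the new random measure satisfies the Ghirlanda-Guerra identities with the same overlap
  law, which is why one can go on, and why it suffices to treat one block. It matters here that the
  functions of a block depend on the overlaps of this block only, not on the earlier ones.

  For one block, scale its potential by t and let T(t) be the tilted average of a bounded function of
  the overlaps of m replicas that include the block. Differentiation in t brings down the sum of the
  potentials at the m replicas minus m times the average of the potential under the tilted measure,
  and this average is the potential at one new tilted replica
  (\<open>E_avg_tilted_replica\<close>). Hence the derivative is again a tilted average, for m + 1
  replicas and the function multiplied by a factor D (\<open>T_has_real_derivative\<close>). If at time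
  t0 tilted averages equal the original ones, then all derivatives at t0 vanish, because the last
  factor D has mean zero: this is exactly the Ghirlanda-Guerra identity
  (\<open>E_avg_D_eq_0\<close>). The j-th derivative is at most C (2L)^j m (m+1) ... (m+j-1), where L
  bounds the potential, so the Taylor series at t0 represents T on an interval after t0 whose length
  depends on neither m nor the function (\<open>T_invariance_step\<close>). Finitely many such
  steps lead from 0 to 1 (\<open>T_1\<close>).

  The Ghirlanda-Guerra identities are given for products of a function of the overlaps and a function
  of one overlap. They are needed for functions of both jointly, because the potential of a replica
  depends on the overlaps in its block; a uniqueness argument for measures on a product space supplies
  this (\<open>ghirlanda_guerra_mixture\<close>).
\<close>

(* Index sets are written {1..}; the rewriting of 1 to Suc 0 would only obscure them. *)
declare One_nat_def [simp del]

section \<open>Differentiation under the integral sign\<close>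

lemma (in finite_measure) has_real_derivative_integral:
  fixes g g' :: "real \<Rightarrow> 'a \<Rightarrow> real"
  assumes deriv: "\<And>t x. t \<in> {a<..<b} \<Longrightarrow> x \<in> space M \<Longrightarrow>
                    ((\<lambda>t. g t x) has_real_derivative g' t x) (at t)"
    and int: "\<And>t. t \<in> {a<..<b} \<Longrightarrow> integrable M (g t)"
    and bound: "\<And>t x. t \<in> {a<..<b} \<Longrightarrow> x \<in> space M \<Longrightarrow> \<bar>g' t x\<bar> \<le> K"
    and meas: "g' t0 \<in> borel_measurable M"
    and t0: "t0 \<in> {a<..<b}"
  shows "((\<lambda>t. \<integral>x. g t x \<partial>M) has_real_derivative (\<integral>x. g' t0 x \<partial>M)) (at t0)"
proof -
  have "((\<lambda>y. ((\<integral>x. g y x \<partial>M) - (\<integral>x. g t0 x \<partial>M)) / (y - t0)) \<longlongrightarrow> (\<integral>x. g' t0 x \<partial>M))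
          (at t0 within {a<..<b})"
    unfolding tendsto_at_iff_sequentially
  proof (intro allI impI)
    fix X :: "nat \<Rightarrow> real"
    assume X: "\<forall>i. X i \<in> {a<..<b} - {t0}" and lim: "X \<longlonglongrightarrow> t0"
    have "(\<lambda>i. \<integral>x. (g (X i) x - g t0 x) / (X i - t0) \<partial>M) \<longlonglongrightarrow> (\<integral>x. g' t0 x \<partial>M)"
    proof (rule integral_dominated_convergence[where w = "\<lambda>_. K"])
      show "AE x in M. (\<lambda>i. (g (X i) x - g t0 x) / (X i - t0)) \<longlonglongrightarrow> g' t0 x"
      proof (rule AE_I2)
        fix x assume "x \<in> space M"
        from deriv[OF t0 this]
        have "((\<lambda>y. (g y x - g t0 x) / (y - t0)) \<longlongrightarrow> g' t0 x) (at t0)"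
          by (simp add: has_field_derivative_iff)
        then show "(\<lambda>i. (g (X i) x - g t0 x) / (X i - t0)) \<longlonglongrightarrow> g' t0 x"
          using X lim unfolding tendsto_at_iff_sequentially by (auto simp: comp_def)
      qed
      show "AE x in M. norm ((g (X i) x - g t0 x) / (X i - t0)) \<le> K" for i
      proof (rule AE_I2)
        fix x assume x: "x \<in> space M"
        have Xi: "X i \<in> {a<..<b}" "X i \<noteq> t0" using X by auto
        have "norm (g (X i) x - g t0 x) \<le> K * norm (X i - t0)"
          by (rule field_differentiable_bound[where S = "{a<..<b}" and f' = "\<lambda>t. g' t x"])
             (use deriv x bound Xi t0 in \<open>auto intro: has_field_derivative_at_within\<close>)
        then show "norm ((g (X i) x - g t0 x) / (X i - t0)) \<le> K"
          using Xi by (simp add: divide_simps)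
      qed
    qed (use X int t0 meas in auto)
    moreover have "(\<integral>x. (g (X i) x - g t0 x) / (X i - t0) \<partial>M)
        = ((\<integral>x. g (X i) x \<partial>M) - (\<integral>x. g t0 x \<partial>M)) / (X i - t0)" for i
      using X int t0 by (subst integral_divide_zero, subst Bochner_Integration.integral_diff) auto
    ultimately show "((\<lambda>y. ((\<integral>x. g y x \<partial>M) - (\<integral>x. g t0 x \<partial>M)) / (y - t0)) \<circ> X)
        \<longlonglongrightarrow> (\<integral>x. g' t0 x \<partial>M)"
      by (simp only: comp_def)
  qed
  then show ?thesis
    using t0 by (simp add: has_field_derivative_iff at_within_open[of t0 "{a<..<b}"])
qed

section \<open>Integrals against probability kernels\<close>

lemma (in prob_space) abs_integral_le:
  fixes f :: "'a \<Rightarrow> real"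
  assumes "f \<in> borel_measurable M" "\<And>x. x \<in> space M \<Longrightarrow> \<bar>f x\<bar> \<le> c"
  shows "\<bar>\<integral>x. f x \<partial>M\<bar> \<le> c"
proof -
  have int: "integrable M f"
    by (rule integrable_const_bound[where B = c]) (use assms in auto)
  have "AE x in M. f x \<le> c" "AE x in M. - c \<le> f x"
    using assms(2) by (auto intro!: AE_I2 simp: abs_le_iff minus_le_iff)
  then show ?thesis
    using integral_le_const[OF int] integral_ge_const[OF int] by (simp add: abs_le_iff minus_le_iff)
qed

lemma borel_measurable_integral_kernel:
  fixes f :: "'a \<Rightarrow> 'b \<Rightarrow> real"
  assumes f: "(\<lambda>(x, y). f x y) \<in> borel_measurable (M \<Otimes>\<^sub>M N)"
    and L: "L \<in> measurable M (subprob_algebra N)"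
  shows "(\<lambda>x. \<integral>y. f x y \<partial>L x) \<in> borel_measurable M"
proof -
  have "(\<lambda>x. distr (L x) (M \<Otimes>\<^sub>M N) (Pair x)) \<in> measurable M (subprob_algebra (M \<Otimes>\<^sub>M N))"
    by (rule measurable_distr2[OF _ L]) (simp add: split_beta')
  from measurable_compose[OF this integral_measurable_subprob_algebra[OF f]]
  have "(\<lambda>x. \<integral>z. (case z of (x, y) \<Rightarrow> f x y) \<partial>distr (L x) (M \<Otimes>\<^sub>M N) (Pair x)) \<in> borel_measurable M" .
  moreover have "(\<integral>z. (case z of (x, y) \<Rightarrow> f x y) \<partial>distr (L x) (M \<Otimes>\<^sub>M N) (Pair x)) = (\<integral>y. f x y \<partial>L x)"
    if x: "x \<in> space M" for x
  proof -
    have "Pair x \<in> measurable (L x) (M \<Otimes>\<^sub>M N)"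
      unfolding measurable_cong_sets[OF sets_kernel[OF L x] refl] using x by simp
    from integral_distr[OF this f] show ?thesis by simp
  qed
  ultimately show ?thesis by (simp cong: measurable_cong)
qed

section \<open>Bounded measurable functions and averages over replicas\<close>

lemma bounded_measurableI:
  assumes "g \<in> borel_measurable N" "\<And>x. x \<in> space N \<Longrightarrow> \<bar>g x\<bar> \<le> c"
  shows "bounded_measurable N g"
  using assms unfolding bounded_measurable_def bounded_iff by auto

lemma bounded_measurableE:
  assumes "bounded_measurable N g"
  obtains c where "g \<in> borel_measurable N" "0 \<le> c" "\<And>x. x \<in> space N \<Longrightarrow> \<bar>g x\<bar> \<le> c"
proof -
  obtain c where "\<And>x. x \<in> space N \<Longrightarrow> \<bar>g x\<bar> \<le> c"
    using assms unfolding bounded_measurable_def bounded_iff by auto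
  then have "\<bar>g x\<bar> \<le> max c 0" if "x \<in> space N" for x
    using that by fastforce
  then show thesis
    using assms that[of "max c 0"] unfolding bounded_measurable_def by auto
qed

lemma bounded_measurable_integrable:
  assumes "finite_measure N" "bounded_measurable N g"
  shows "integrable N g"
proof -
  from assms(2) obtain c where "g \<in> borel_measurable N" "\<And>x. x \<in> space N \<Longrightarrow> \<bar>g x\<bar> \<le> c"
    by (auto elim!: bounded_measurableE)
  with assms(1) show ?thesis
    by (intro finite_measure.integrable_const_bound[where B = c]) auto
qed

lemma bounded_measurable_const [intro, simp]: "bounded_measurable N (\<lambda>_. c)"
  by (rule bounded_measurableI[where c = "\<bar>c\<bar>"]) auto

lemma bounded_measurable_add:
  assumes "bounded_measurable N g" "bounded_measurable N h"
  shows "bounded_measurable N (\<lambda>x. g x + h x)"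
proof -
  from assms obtain c d where "g \<in> borel_measurable N" "h \<in> borel_measurable N"
    and *: "\<And>x. x \<in> space N \<Longrightarrow> \<bar>g x\<bar> \<le> c" "\<And>x. x \<in> space N \<Longrightarrow> \<bar>h x\<bar> \<le> d"
    by (auto elim!: bounded_measurableE)
  moreover have "\<bar>g x + h x\<bar> \<le> c + d" if "x \<in> space N" for x
    using *[OF that] by linarith
  ultimately show ?thesis by (auto intro!: bounded_measurableI)
qed

lemma bounded_measurable_mult:
  assumes "bounded_measurable N g" "bounded_measurable N h"
  shows "bounded_measurable N (\<lambda>x. g x * h x)"
proof -
  from assms obtain c d where "g \<in> borel_measurable N" "h \<in> borel_measurable N" "c \<ge> 0"
    and *: "\<And>x. x \<in> space N \<Longrightarrow> \<bar>g x\<bar> \<le> c" "\<And>x. x \<in> space N \<Longrightarrow> \<bar>h x\<bar> \<le> d"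
    by (auto elim!: bounded_measurableE)
  moreover from this have "\<bar>g x * h x\<bar> \<le> c * d" if "x \<in> space N" for x
    using *[OF that] by (auto simp: abs_mult intro!: mult_mono)
  ultimately show ?thesis by (auto intro!: bounded_measurableI)
qed

lemma bounded_measurable_diff:
  assumes "bounded_measurable N g" "bounded_measurable N h"
  shows "bounded_measurable N (\<lambda>x. g x - h x)"
  using bounded_measurable_add[OF assms(1) bounded_measurable_mult[OF bounded_measurable_const[where c = "-1"] assms(2)]]
  by simp

lemma bounded_measurable_sum:
  assumes "\<And>i. i \<in> I \<Longrightarrow> bounded_measurable N (g i)"
  shows "bounded_measurable N (\<lambda>x. \<Sum>i\<in>I. g i x)"
  using assms by (induction I rule: infinite_finite_induct) (auto intro!: bounded_measurable_add)

lemma bounded_measurable_prod: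
  assumes "\<And>i. i \<in> I \<Longrightarrow> bounded_measurable N (g i)"
  shows "bounded_measurable N (\<lambda>x. \<Prod>i\<in>I. g i x :: real)"
  using assms by (induction I rule: infinite_finite_induct) (auto intro!: bounded_measurable_mult)

lemma bounded_measurable_exp:
  assumes "bounded_measurable N g"
  shows "bounded_measurable N (\<lambda>x. exp (g x))"
proof -
  from assms obtain c where "g \<in> borel_measurable N" "\<And>x. x \<in> space N \<Longrightarrow> \<bar>g x\<bar> \<le> c"
    by (auto elim!: bounded_measurableE)
  then show ?thesis by (intro bounded_measurableI[where c = "exp c"]) force+
qed

lemma bounded_measurable_power:
  fixes g :: "'a \<Rightarrow> real"
  assumes "bounded_measurable N g"
  shows "bounded_measurable N (\<lambda>x. g x ^ k)"
  by (induction k) (auto intro!: bounded_measurable_mult assms)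

lemma bounded_measurable_inverse:
  assumes "bounded_measurable N g" "0 < d" "\<And>x. x \<in> space N \<Longrightarrow> d \<le> g x"
  shows "bounded_measurable N (\<lambda>x. inverse (g x))"
proof (rule bounded_measurableI)
  show "(\<lambda>x. inverse (g x)) \<in> borel_measurable N"
    using assms(1) unfolding bounded_measurable_def by (auto intro: borel_measurable_inverse)
  show "\<bar>inverse (g x)\<bar> \<le> inverse d" if "x \<in> space N" for x
    using assms(2) assms(3)[OF that] by (simp add: le_imp_inverse_le)
qed

lemma bounded_measurable_compose:
  assumes "h \<in> measurable N' N" "bounded_measurable N g"
  shows "bounded_measurable N' (\<lambda>x. g (h x))"
proof -
  from assms(2) obtain c where "g \<in> borel_measurable N" "\<And>x. x \<in> space N \<Longrightarrow> \<bar>g x\<bar> \<le> c"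
    by (auto elim!: bounded_measurableE)
  with assms(1) show ?thesis
    by (intro bounded_measurableI[where c = c]) (auto dest: measurable_space)
qed

text \<open>The measurable space of replica sequences. As in the product measure that defines the
  averages, replicas are numbered from 1, so that sequences in the space are undefined at 0.\<close>

abbreviation replica_space :: "(nat \<Rightarrow> 'h::topological_space) measure" where
  "replica_space \<equiv> \<Pi>\<^sub>M l\<in>{1..}. borel"

text \<open>A random probability measure on the whole Hilbert space.\<close>

locale random_measure =
  fixes M :: "'w measure"
    and G :: "'w \<Rightarrow> 'h::{real_inner, complete_space, second_countable_topology} measure"
  assumes prob_M: "prob_space M"
    and meas_G [measurable]: "G \<in> measurable M (prob_algebra borel)"
begin

abbreviation rspace :: "(nat \<Rightarrow> 'h) measure" where
  "rspace \<equiv> replica_space"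

lemma prob_G: "\<omega> \<in> space M \<Longrightarrow> prob_space (G \<omega>)"
  using measurable_space[OF meas_G] by (auto simp: space_prob_algebra)

lemma sets_G: "\<omega> \<in> space M \<Longrightarrow> sets (G \<omega>) = sets borel"
  using measurable_space[OF meas_G] by (auto simp: space_prob_algebra)

lemma space_G: "\<omega> \<in> space M \<Longrightarrow> space (G \<omega>) = UNIV"
  using sets_eq_imp_space_eq[OF sets_G] by simp

text \<open>The law of the replicas for a given realisation of the random measure.\<close>

definition replicas :: "'w \<Rightarrow> (nat \<Rightarrow> 'h) measure" where
  "replicas \<omega> = (\<Pi>\<^sub>M l\<in>{1..}. G \<omega>)"

lemma sets_replicas: "\<omega> \<in> space M \<Longrightarrow> sets (replicas \<omega>) = sets replica_space"
  unfolding replicas_def by (intro sets_PiM_cong) (auto simp: sets_G)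

lemma prob_replicas: "\<omega> \<in> space M \<Longrightarrow> prob_space (replicas \<omega>)"
  unfolding replicas_def by (intro prob_space_PiM prob_G)

text \<open>On cylinders the infinite product measure is a finite product, which is measurable in the
  realisation; cylinders generate the product sigma-algebra.\<close>

lemma meas_replicas [measurable]: "replicas \<in> measurable M (prob_algebra replica_space)"
proof (rule measurable_prob_algebra_generated[OF sets_PiM Int_stable_prod_algebra prod_algebra_sets_into_space])
  fix A :: "(nat \<Rightarrow> 'h) set"
  assume "A \<in> prod_algebra {1..} (\<lambda>_. borel)"
  then obtain J E where A: "A = prod_emb {1..} (\<lambda>_. borel) J (\<Pi>\<^sub>E j\<in>J. E j)"
    and J: "finite J" "J \<subseteq> {1..}" and E: "\<And>j. j \<in> J \<Longrightarrow> E j \<in> sets borel"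
    by (auto elim!: prod_algebraE)
  have "emeasure (replicas \<omega>) A = (\<Prod>j\<in>J. emeasure (G \<omega>) (E j))" if \<omega>: "\<omega> \<in> space M" for \<omega>
  proof -
    have "A = prod_emb {1..} (\<lambda>_. G \<omega>) J (\<Pi>\<^sub>E j\<in>J. E j)"
      by (simp add: A prod_emb_def space_G[OF \<omega>])
    then show ?thesis
      unfolding replicas_def using J E prob_G[OF \<omega>] sets_G[OF \<omega>]
      by (simp add: emeasure_PiM_emb)
  qed
  moreover have "(\<lambda>\<omega>. \<Prod>j\<in>J. emeasure (G \<omega>) (E j)) \<in> borel_measurable M"
  proof (rule borel_measurable_prod_ennreal)
    fix j assume "j \<in> J"
    from E[OF this] show "(\<lambda>\<omega>. emeasure (G \<omega>) (E j)) \<in> borel_measurable M"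
      using measurable_prob_algebraD[OF meas_G] by measurable
  qed
  ultimately show "(\<lambda>\<omega>. emeasure (replicas \<omega>) A) \<in> borel_measurable M"
    by (simp cong: measurable_cong)
qed (auto simp: prob_replicas sets_replicas)

text \<open>The joint law of the randomness and the replicas. It turns the iterated integral of the
  averages into a single integral against a probability measure.\<close>

definition joint_law :: "('w \<times> (nat \<Rightarrow> 'h)) measure" where
  "joint_law = M \<bind> (\<lambda>\<omega>. distr (replicas \<omega>) (M \<Otimes>\<^sub>M replica_space) (Pair \<omega>))"

text \<open>Bounded, jointly measurable integrands. The first argument ranges over the space of the
  randomness and the second over the replicas.\<close>

abbreviation bm :: "('w \<Rightarrow> (nat \<Rightarrow> 'h) \<Rightarrow> real) \<Rightarrow> bool" where
  "bm g \<equiv> bounded_measurable (M \<Otimes>\<^sub>M replica_space) (\<lambda>x. g (fst x) (snd x))"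

lemma M_in_prob_algebra: "M \<in> space (prob_algebra M)"
  by (simp add: space_prob_algebra prob_M)

lemma joint_kernel:
  "(\<lambda>\<omega>. distr (replicas \<omega>) (M \<Otimes>\<^sub>M replica_space) (Pair \<omega>))
     \<in> measurable M (prob_algebra (M \<Otimes>\<^sub>M replica_space))"
  by (rule measurable_distr_prob_space2[OF meas_replicas]) simp

lemma sets_joint_law: "sets joint_law = sets (M \<Otimes>\<^sub>M replica_space)"
  unfolding joint_law_def using M_in_prob_algebra joint_kernel by (rule sets_bind')

lemma prob_joint_law: "prob_space joint_law"
  unfolding joint_law_def using M_in_prob_algebra joint_kernel by (rule prob_space_bind')

lemma space_joint_law: "space joint_law = space M \<times> space replica_space"
  using sets_eq_imp_space_eq[OF sets_joint_law] by (simp add: space_pair_measure)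

lemma E_avg_eq_joint_law:
  assumes "bm g"
  shows "E_avg M G g = (\<integral>x. g (fst x) (snd x) \<partial>joint_law)"
proof -
  interpret prob_space M by (rule prob_M)
  obtain c where g: "(\<lambda>x. g (fst x) (snd x)) \<in> borel_measurable (M \<Otimes>\<^sub>M replica_space)"
    and c: "\<And>x. x \<in> space (M \<Otimes>\<^sub>M replica_space) \<Longrightarrow> \<bar>g (fst x) (snd x)\<bar> \<le> c"
    using assms by (auto elim!: bounded_measurableE)
  have "(\<integral>x. g (fst x) (snd x) \<partial>joint_law)
      = (\<integral>\<omega>. (\<integral>x. g (fst x) (snd x) \<partial>distr (replicas \<omega>) (M \<Otimes>\<^sub>M replica_space) (Pair \<omega>)) \<partial>M)"
    unfolding joint_law_def
  proof (rule integral_bind[where K = "M \<Otimes>\<^sub>M replica_space" and B' = 1 and B = c])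
    have "emeasure (distr (replicas x) (M \<Otimes>\<^sub>M replica_space) (Pair x))
            (space (distr (replicas x) (M \<Otimes>\<^sub>M replica_space) (Pair x))) \<le> ennreal 1"
      if "x \<in> space M" for x
      using measurable_space[OF joint_kernel that] prob_space.emeasure_space_1
      by (fastforce simp: space_prob_algebra simp del: space_distr)
    then show "AE x in M. emeasure (distr (replicas x) (M \<Otimes>\<^sub>M replica_space) (Pair x))
            (space (distr (replicas x) (M \<Otimes>\<^sub>M replica_space) (Pair x))) \<le> ennreal 1"
      by (auto intro!: AE_I2)
  qed (use g c joint_kernel not_empty in \<open>auto intro: measurable_prob_algebraD\<close>)
  also have "\<dots> = (\<integral>\<omega>. (\<integral>\<sigma>. g \<omega> \<sigma> \<partial>replicas \<omega>) \<partial>M)"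
  proof (rule Bochner_Integration.integral_cong[OF refl])
    fix \<omega> assume \<omega>: "\<omega> \<in> space M"
    have "Pair \<omega> \<in> measurable (replicas \<omega>) (M \<Otimes>\<^sub>M replica_space)"
      by (simp add: measurable_cong_sets[OF sets_replicas[OF \<omega>] refl] \<omega>)
    then show "(\<integral>x. g (fst x) (snd x) \<partial>distr (replicas \<omega>) (M \<Otimes>\<^sub>M replica_space) (Pair \<omega>))
        = (\<integral>\<sigma>. g \<omega> \<sigma> \<partial>replicas \<omega>)"
      using g by (simp add: integral_distr)
  qed
  finally show ?thesis by (simp add: E_avg_def replicas_def)
qed

lemma bm_cong_sets: "bm g \<longleftrightarrow> bounded_measurable joint_law (\<lambda>x. g (fst x) (snd x))"
  unfolding bounded_measurable_def
  by (simp add: sets_eq_imp_space_eq[OF sets_joint_law] measurable_cong_sets[OF sets_joint_law refl])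

lemma bm_integrable: "bm g \<Longrightarrow> integrable joint_law (\<lambda>x. g (fst x) (snd x))"
  using bounded_measurable_integrable[OF prob_space.finite_measure[OF prob_joint_law]]
  by (simp only: bm_cong_sets)

lemma E_avg_cong:
  assumes "\<And>\<omega> \<sigma>. \<omega> \<in> space M \<Longrightarrow> \<sigma> \<in> space rspace \<Longrightarrow> g \<omega> \<sigma> = h \<omega> \<sigma>"
  shows "E_avg M G g = E_avg M G h"
  unfolding E_avg_def replicas_def[symmetric] using assms
  by (intro Bochner_Integration.integral_cong refl) (simp_all add: sets_eq_imp_space_eq[OF sets_replicas])

lemma E_avg_add: "bm g \<Longrightarrow> bm h \<Longrightarrow> E_avg M G (\<lambda>\<omega> \<sigma>. g \<omega> \<sigma> + h \<omega> \<sigma>) = E_avg M G g + E_avg M G h"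
  by (simp add: E_avg_eq_joint_law bm_integrable bounded_measurable_add)

lemma E_avg_diff: "bm g \<Longrightarrow> bm h \<Longrightarrow> E_avg M G (\<lambda>\<omega> \<sigma>. g \<omega> \<sigma> - h \<omega> \<sigma>) = E_avg M G g - E_avg M G h"
  by (simp add: E_avg_eq_joint_law bm_integrable bounded_measurable_diff)

lemma E_avg_cmult: "E_avg M G (\<lambda>\<omega> \<sigma>. c * g \<omega> \<sigma>) = c * E_avg M G g"
  by (simp add: E_avg_def)

lemma E_avg_sum:
  "(\<And>i. i \<in> I \<Longrightarrow> bm (g i)) \<Longrightarrow> E_avg M G (\<lambda>\<omega> \<sigma>. \<Sum>i\<in>I. g i \<omega> \<sigma>) = (\<Sum>i\<in>I. E_avg M G (g i))"
  by (simp add: E_avg_eq_joint_law bm_integrable bounded_measurable_sum)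

lemma E_avg_mono:
  assumes "bm g" "bm h" "\<And>\<omega> \<sigma>. \<omega> \<in> space M \<Longrightarrow> \<sigma> \<in> space rspace \<Longrightarrow> g \<omega> \<sigma> \<le> h \<omega> \<sigma>"
  shows "E_avg M G g \<le> E_avg M G h"
  using assms
  by (auto simp: E_avg_eq_joint_law space_joint_law intro!: integral_mono bm_integrable)

lemma E_avg_const: "E_avg M G (\<lambda>\<omega> \<sigma>. c) = c"
  using prob_space.prob_space[OF prob_joint_law] by (simp add: E_avg_eq_joint_law)

lemma E_avg_has_real_derivative:
  fixes g g' :: "real \<Rightarrow> 'w \<Rightarrow> (nat \<Rightarrow> 'h) \<Rightarrow> real"
  assumes deriv: "\<And>t \<omega> \<sigma>. t \<in> {a<..<b} \<Longrightarrow> \<omega> \<in> space M \<Longrightarrow> \<sigma> \<in> space rspace \<Longrightarrow>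
                    ((\<lambda>t. g t \<omega> \<sigma>) has_real_derivative g' t \<omega> \<sigma>) (at t)"
    and g: "\<And>t. t \<in> {a<..<b} \<Longrightarrow> bm (g t)"
    and g': "bm (g' t0)"
    and bound: "\<And>t \<omega> \<sigma>. t \<in> {a<..<b} \<Longrightarrow> \<omega> \<in> space M \<Longrightarrow> \<sigma> \<in> space rspace \<Longrightarrow> \<bar>g' t \<omega> \<sigma>\<bar> \<le> K"
    and t0: "t0 \<in> {a<..<b}"
  shows "((\<lambda>t. E_avg M G (g t)) has_real_derivative E_avg M G (g' t0)) (at t0)"
proof -
  interpret prob_space joint_law by (rule prob_joint_law)
  have "((\<lambda>t. \<integral>x. g t (fst x) (snd x) \<partial>joint_law) has_real_derivative
          (\<integral>x. g' t0 (fst x) (snd x) \<partial>joint_law)) (at t0)"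
    by (rule has_real_derivative_integral[where a = a and b = b and K = K
          and g' = "\<lambda>t x. g' t (fst x) (snd x)"])
       (use assms bm_integrable[OF g'] in \<open>auto simp: space_joint_law intro: bm_integrable\<close>)
  then have "((\<lambda>t. \<integral>x. g t (fst x) (snd x) \<partial>joint_law) has_real_derivative E_avg M G (g' t0)) (at t0)"
    using E_avg_eq_joint_law[OF g'] by (simp only:)
  then show ?thesis
    by (rule has_field_derivative_transform_within_open[where S = "{a<..<b}"])
       (use t0 g in \<open>auto simp: E_avg_eq_joint_law\<close>)
qed

lemma bounded_measurable_integral_G:
  fixes k :: "'a \<Rightarrow> 'h \<Rightarrow> real"
  assumes k: "bounded_measurable (N \<Otimes>\<^sub>M borel) (\<lambda>(z, s). k z s)" and p: "p \<in> measurable N M"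
  shows "bounded_measurable N (\<lambda>z. \<integral>s. k z s \<partial>G (p z))"
proof -
  obtain c where km: "(\<lambda>(z, s). k z s) \<in> borel_measurable (N \<Otimes>\<^sub>M borel)"
    and c0: "\<And>x. x \<in> space (N \<Otimes>\<^sub>M borel) \<Longrightarrow> \<bar>case x of (z, s) \<Rightarrow> k z s\<bar> \<le> c"
    using bounded_measurableE[OF k] by metis
  show ?thesis
  proof (rule bounded_measurableI)
    show "(\<lambda>z. \<integral>s. k z s \<partial>G (p z)) \<in> borel_measurable N"
      by (rule borel_measurable_integral_kernel[OF km])
         (rule measurable_compose[OF p measurable_prob_algebraD[OF meas_G]])
    fix z assume z: "z \<in> space N"
    then have pz: "p z \<in> space M" using p by (rule measurable_space[rotated])
    show "\<bar>\<integral>s. k z s \<partial>G (p z)\<bar> \<le> c"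
    proof (rule prob_space.abs_integral_le[OF prob_G[OF pz]])
      show "k z \<in> borel_measurable (G (p z))"
        unfolding measurable_cong_sets[OF sets_G[OF pz] refl]
        using measurable_compose[OF measurable_Pair1'[OF z] km] by simp
      show "\<bar>k z s\<bar> \<le> c" for s
        using c0[of "(z, s)"] z by (simp add: space_pair_measure)
    qed
  qed
qed

text \<open>An integral against the random measure can be traded for the evaluation at a replica on which
  the integrand does not depend otherwise.\<close>

lemma E_avg_fresh_replica:
  assumes h: "bounded_measurable ((M \<Otimes>\<^sub>M replica_space) \<Otimes>\<^sub>M borel) (\<lambda>x. h (fst (fst x)) (snd (fst x)) (snd x))"
    and j: "1 \<le> j"
    and indep: "\<And>\<omega> \<sigma> y s. h \<omega> (\<sigma>(j := y)) s = h \<omega> \<sigma> s"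
  shows "E_avg M G (\<lambda>\<omega> \<sigma>. \<integral>s. h \<omega> \<sigma> s \<partial>G \<omega>) = E_avg M G (\<lambda>\<omega> \<sigma>. h \<omega> \<sigma> (\<sigma> j))"
  unfolding E_avg_def
proof (rule Bochner_Integration.integral_cong[OF refl])
  fix \<omega> assume \<omega>: "\<omega> \<in> space M"
  let ?J = "{1..} - {j}"
  have ins: "insert j ?J = {1..}" using j by auto
  interpret G: prob_space "G \<omega>" by (rule prob_G[OF \<omega>])
  interpret Q: prob_space "\<Pi>\<^sub>M l\<in>?J. G \<omega>" by (rule prob_space_PiM) (rule prob_G[OF \<omega>])
  interpret GQ: pair_prob_space "G \<omega>" "\<Pi>\<^sub>M l\<in>?J. G \<omega>" ..
  let ?u = "\<lambda>(x, X). X(j := x)"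
  note sG [measurable_cong] = sets_G[OF \<omega>]
  have [measurable]: "\<omega> \<in> space M" by fact
  obtain c where hm [measurable]: "(\<lambda>x. h (fst (fst x)) (snd (fst x)) (snd x))
                      \<in> borel_measurable ((M \<Otimes>\<^sub>M replica_space) \<Otimes>\<^sub>M borel)"
    and c: "\<And>x. x \<in> space ((M \<Otimes>\<^sub>M replica_space) \<Otimes>\<^sub>M borel)
              \<Longrightarrow> \<bar>h (fst (fst x)) (snd (fst x)) (snd x)\<bar> \<le> c"
    using h by (auto elim!: bounded_measurableE)
  have bound: "\<bar>h \<omega> X s\<bar> \<le> c" if "X \<in> space replica_space" for X s
    using c[of "((\<omega>, X), s)"] that \<omega> by (simp add: space_pair_measure)
  have u: "?u \<in> measurable (G \<omega> \<Otimes>\<^sub>M (\<Pi>\<^sub>M l\<in>?J. G \<omega>)) (\<Pi>\<^sub>M l\<in>{1..}. G \<omega>)"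
  proof -
    have "?u \<in> measurable (G \<omega> \<Otimes>\<^sub>M (\<Pi>\<^sub>M l\<in>?J. G \<omega>)) (\<Pi>\<^sub>M l\<in>insert j ?J. G \<omega>)"
      by measurable
    then show ?thesis by (simp only: ins)
  qed
  have sPi: "sets (\<Pi>\<^sub>M l\<in>{1..}. G \<omega>) = sets (\<Pi>\<^sub>M l\<in>{1..}. borel)"
    by (intro sets_PiM_cong) (auto simp: sG)
  note spPi = sets_eq_imp_space_eq[OF sPi]
  have hpair: "(\<lambda>x. h \<omega> (fst x) (snd x)) \<in> borel_measurable (replica_space \<Otimes>\<^sub>M borel)"
  proof -
    have "(\<lambda>x. ((\<omega>, fst x), snd x)) \<in> measurable (replica_space \<Otimes>\<^sub>M borel) ((M \<Otimes>\<^sub>M replica_space) \<Otimes>\<^sub>M borel)"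
      by measurable
    from measurable_compose[OF this hm] show ?thesis by simp
  qed
  have hpairG: "(\<lambda>x. h \<omega> (fst x) (snd x)) \<in> borel_measurable ((\<Pi>\<^sub>M l\<in>{1..}. G \<omega>) \<Otimes>\<^sub>M G \<omega>)"
    using hpair measurable_cong_sets[OF sets_pair_measure_cong[OF sPi sG] refl] by blast
  define k where "k \<sigma> = (\<integral>s. h \<omega> \<sigma> s \<partial>G \<omega>)" for \<sigma>
  have k_meas: "k \<in> borel_measurable (\<Pi>\<^sub>M l\<in>{1..}. G \<omega>)"
    unfolding k_def by (rule G.borel_measurable_lebesgue_integral) (use hpairG in \<open>simp add: split_beta'\<close>)
  have k_upd: "k (X(j := y)) = k X" for X y
    by (simp add: k_def indep)
  have u_sp: "X(j := x) \<in> space replica_space" if "X \<in> space (\<Pi>\<^sub>M l\<in>?J. G \<omega>)" for x X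
    using that j by (auto simp: space_PiM PiE_iff extensional_def)
  have h1: "(\<lambda>x. h \<omega> x (x j)) \<in> borel_measurable (\<Pi>\<^sub>M l\<in>{1..}. G \<omega>)"
  proof -
    have "j \<in> {1..}" using j by simp
    then have "(\<lambda>x. (x, x j)) \<in> measurable (\<Pi>\<^sub>M l\<in>{1..}. G \<omega>) ((\<Pi>\<^sub>M l\<in>{1..}. G \<omega>) \<Otimes>\<^sub>M G \<omega>)"
      by measurable
    from measurable_compose[OF this hpairG] show ?thesis by simp
  qed
  note D = distr_pair_PiM_eq_PiM[of ?J "\<lambda>_. G \<omega>" j, OF prob_G[OF \<omega>] prob_G[OF \<omega>], unfolded ins]
  have "(\<integral>\<sigma>. h \<omega> \<sigma> (\<sigma> j) \<partial>(\<Pi>\<^sub>M l\<in>{1..}. G \<omega>))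
      = (\<integral>p. h \<omega> ((snd p)(j := fst p)) (fst p) \<partial>(G \<omega> \<Otimes>\<^sub>M (\<Pi>\<^sub>M l\<in>?J. G \<omega>)))"
    by (subst D[symmetric]) (use u h1 in \<open>simp add: integral_distr split_beta'\<close>)
  also have "\<dots> = (\<integral>X. (\<integral>x. h \<omega> (X(j := x)) x \<partial>G \<omega>) \<partial>(\<Pi>\<^sub>M l\<in>?J. G \<omega>))"
  proof -
    have m: "(\<lambda>p. h \<omega> ((snd p)(j := fst p)) (fst p)) \<in> borel_measurable (G \<omega> \<Otimes>\<^sub>M (\<Pi>\<^sub>M l\<in>?J. G \<omega>))"
      using measurable_compose[OF u h1] by (simp add: split_beta')
    have "integrable (G \<omega> \<Otimes>\<^sub>M (\<Pi>\<^sub>M l\<in>?J. G \<omega>)) (\<lambda>p. h \<omega> ((snd p)(j := fst p)) (fst p))"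
      by (rule GQ.integrable_const_bound[where B = c])
         (use m in \<open>auto simp: space_pair_measure intro!: bound u_sp\<close>)
    from GQ.integral_snd[of "\<lambda>x X. h \<omega> (X(j := x)) x"] this show ?thesis
      by (simp add: split_beta')
  qed
  also have "\<dots> = (\<integral>X. k X \<partial>(\<Pi>\<^sub>M l\<in>?J. G \<omega>))"
    by (simp add: k_def indep)
  also have "\<dots> = (\<integral>X. (\<integral>x. k (X(j := x)) \<partial>G \<omega>) \<partial>(\<Pi>\<^sub>M l\<in>?J. G \<omega>))"
    by (simp add: k_upd G.prob_space)
  also have "\<dots> = (\<integral>p. k ((snd p)(j := fst p)) \<partial>(G \<omega> \<Otimes>\<^sub>M (\<Pi>\<^sub>M l\<in>?J. G \<omega>)))"
  proof -
    have m: "(\<lambda>p. k ((snd p)(j := fst p))) \<in> borel_measurable (G \<omega> \<Otimes>\<^sub>M (\<Pi>\<^sub>M l\<in>?J. G \<omega>))"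
      using measurable_compose[OF u k_meas] by (simp add: split_beta')
    have kb: "\<bar>k X\<bar> \<le> c" if "X \<in> space replica_space" for X
    proof -
      have "(\<lambda>s. h \<omega> X s) \<in> borel_measurable (G \<omega>)"
        using measurable_compose[OF measurable_Pair1'[of X "replica_space" borel] hpair] that
          measurable_cong_sets[OF sG refl] by auto
      then show ?thesis
        unfolding k_def by (rule G.abs_integral_le) (rule bound[OF that])
    qed
    have "integrable (G \<omega> \<Otimes>\<^sub>M (\<Pi>\<^sub>M l\<in>?J. G \<omega>)) (\<lambda>p. k ((snd p)(j := fst p)))"
      by (rule GQ.integrable_const_bound[where B = c])
         (use m in \<open>auto simp: space_pair_measure intro!: kb u_sp\<close>)
    from GQ.integral_snd[of "\<lambda>x X. k (X(j := x))"] this show ?thesis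
      by (simp add: split_beta')
  qed
  also have "\<dots> = (\<integral>\<sigma>. k \<sigma> \<partial>(\<Pi>\<^sub>M l\<in>{1..}. G \<omega>))"
    using integral_distr[OF u k_meas] unfolding D by (simp add: split_beta')
  finally show "(\<integral>\<sigma>. (\<integral>s. h \<omega> \<sigma> s \<partial>G \<omega>) \<partial>(\<Pi>\<^sub>M l\<in>{1..}. G \<omega>)) = (\<integral>\<sigma>. h \<omega> \<sigma> (\<sigma> j) \<partial>(\<Pi>\<^sub>M l\<in>{1..}. G \<omega>))"
    by (simp add: k_def)
qed

text \<open>The replicas are exchangeable, and any subsequence of them has the same law.\<close>

lemma E_avg_reindex:
  assumes g: "bm g"
    and pi: "inj_on \<pi> {1..}" "\<pi> \<in> {1..} \<rightarrow> {1..}"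
  shows "E_avg M G (\<lambda>\<omega> \<sigma>. g \<omega> (\<lambda>l\<in>{1..}. \<sigma> (\<pi> l))) = E_avg M G g"
  unfolding E_avg_def
proof (rule Bochner_Integration.integral_cong[OF refl])
  fix \<omega> assume \<omega>: "\<omega> \<in> space M"
  note sPi = sets_replicas[OF \<omega>, unfolded replicas_def]
  have "g \<omega> \<in> borel_measurable replica_space"
    using g \<omega> measurable_compose[OF measurable_Pair1'[of \<omega> M replica_space], of "\<lambda>x. g (fst x) (snd x)" borel]
    by (auto simp: bounded_measurable_def)
  then have gm: "g \<omega> \<in> borel_measurable (\<Pi>\<^sub>M l\<in>{1..}. G \<omega>)"
    by (simp add: measurable_cong_sets[OF sPi refl])
  have pm: "(\<lambda>\<sigma>. \<lambda>l\<in>{1..}. \<sigma> (\<pi> l)) \<in> measurable (\<Pi>\<^sub>M l\<in>{1..}. G \<omega>) (\<Pi>\<^sub>M l\<in>{1..}. G \<omega>)"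
    by (intro measurable_restrict measurable_component_singleton) (use pi in auto)
  have "distr (\<Pi>\<^sub>M l\<in>{1..}. G \<omega>) (\<Pi>\<^sub>M l\<in>{1..}. G \<omega>) (\<lambda>\<sigma>. \<lambda>l\<in>{1..}. \<sigma> (\<pi> l)) = (\<Pi>\<^sub>M l\<in>{1..}. G \<omega>)"
    using distr_PiM_reindex[of "{1..}" "\<lambda>_. G \<omega>" \<pi> "{1..}"] prob_G[OF \<omega>] pi by simp
  from integral_distr[OF pm gm, unfolded this]
  show "(\<integral>\<sigma>. g \<omega> (\<lambda>l\<in>{1..}. \<sigma> (\<pi> l)) \<partial>(\<Pi>\<^sub>M l\<in>{1..}. G \<omega>)) = (\<integral>\<sigma>. g \<omega> \<sigma> \<partial>(\<Pi>\<^sub>M l\<in>{1..}. G \<omega>))"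
    by simp
qed

end

section \<open>The sigma-algebra of the overlaps of a set of replicas\<close>

text \<open>The sigma-algebra generated by the overlaps within J, self-overlaps included, on the type of
  all replica sequences. A function of these overlaps is encoded as a function on replica sequences
  that is measurable for this sigma-algebra; no factorisation through the array of overlaps is
  needed.\<close>

definition overlap_algebra :: "nat set \<Rightarrow> (nat \<Rightarrow> 'h::real_inner) measure" where
  "overlap_algebra J = vimage_algebra UNIV (overlaps (J \<times> J)) (\<Pi>\<^sub>M a\<in>J \<times> J. borel)"

lemma space_overlap_algebra [simp]: "space (overlap_algebra J) = UNIV"
  by (simp add: overlap_algebra_def)

lemma overlaps_in_space: "overlaps A \<sigma> \<in> space (\<Pi>\<^sub>M a\<in>A. borel)"
  by (auto simp: overlaps_def space_PiM)

lemma measurable_overlapsI: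
  assumes "\<And>i j. (i, j) \<in> A \<Longrightarrow> (\<lambda>x. g x i \<bullet> g x j) \<in> borel_measurable N"
  shows "(\<lambda>x. overlaps A (g x)) \<in> measurable N (\<Pi>\<^sub>M a\<in>A. borel)"
  unfolding overlaps_def by (rule measurable_restrict) (use assms in auto)

lemma measurable_inner_overlap_algebra:
  assumes "i \<in> J" "j \<in> J"
  shows "(\<lambda>\<sigma>. \<sigma> i \<bullet> \<sigma> j) \<in> borel_measurable (overlap_algebra J)"
proof -
  have "overlaps (J \<times> J) \<in> measurable (overlap_algebra J) (\<Pi>\<^sub>M a\<in>J \<times> J. borel)"
    unfolding overlap_algebra_def
    by (rule measurable_vimage_algebra1) (use overlaps_in_space in blast)
  from measurable_compose[OF this measurable_component_singleton[of "(i, j)"]] assms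
  show ?thesis by (simp add: overlaps_def)
qed

lemma measurable_to_overlap_algebra:
  assumes "\<And>i j. i \<in> J \<Longrightarrow> j \<in> J \<Longrightarrow> (\<lambda>x. g x i \<bullet> g x j) \<in> borel_measurable N"
  shows "g \<in> measurable N (overlap_algebra J)"
  unfolding overlap_algebra_def
  by (rule measurable_vimage_algebra2) (use assms in \<open>auto intro: measurable_overlapsI\<close>)

lemma overlap_algebra_mono:
  assumes "J \<subseteq> K"
  shows "(\<lambda>\<sigma>. \<sigma>) \<in> measurable (overlap_algebra K) (overlap_algebra J)"
  by (rule measurable_to_overlap_algebra) (use assms in \<open>auto intro: measurable_inner_overlap_algebra\<close>)

lemma measurable_overlaps_overlap_algebra:
  assumes "A \<subseteq> J \<times> J"
  shows "overlaps A \<in> measurable (overlap_algebra J) (\<Pi>\<^sub>M a\<in>A. borel)"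
  by (rule measurable_overlapsI) (use assms in \<open>auto intro: measurable_inner_overlap_algebra\<close>)

lemma replica_space_to_overlap_algebra:
  assumes "J \<subseteq> {1..}"
  shows "(\<lambda>\<sigma>. \<sigma>) \<in> measurable replica_space
    (overlap_algebra J :: (nat \<Rightarrow> 'h::{real_inner, second_countable_topology}) measure)"
proof (rule measurable_to_overlap_algebra)
  fix i j assume "i \<in> J" "j \<in> J"
  with assms have "i \<in> {1..}" "j \<in> {1..}" by auto
  then show "(\<lambda>x. x i \<bullet> x j :: real) \<in> borel_measurable (replica_space :: (nat \<Rightarrow> 'h) measure)"
    by measurable
qed

text \<open>A function measurable for this sigma-algebra depends on the replicas in J only.\<close>

lemma overlap_algebra_cong:
  fixes \<Psi> :: "(nat \<Rightarrow> 'h::real_inner) \<Rightarrow> real"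
  assumes "\<Psi> \<in> borel_measurable (overlap_algebra J)" "\<And>i. i \<in> J \<Longrightarrow> \<sigma> i = \<tau> i"
  shows "\<Psi> \<sigma> = \<Psi> \<tau>"
proof -
  have "\<Psi> -` {\<Psi> \<sigma>} \<inter> space (overlap_algebra J) \<in> sets (overlap_algebra J)"
    by (rule measurable_sets[OF assms(1)]) simp
  then obtain A where A: "\<Psi> -` {\<Psi> \<sigma>} = overlaps (J \<times> J) -` A"
    unfolding overlap_algebra_def
    by (subst (asm) sets_vimage_algebra2) (use overlaps_in_space in auto)
  have "overlaps (J \<times> J) \<sigma> = overlaps (J \<times> J) \<tau>"
    using assms(2) by (auto simp: overlaps_def)
  then have "\<sigma> \<in> overlaps (J \<times> J) -` A \<longleftrightarrow> \<tau> \<in> overlaps (J \<times> J) -` A"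
    by simp
  then show ?thesis unfolding A[symmetric] by simp
qed

lemma overlap_algebra_cong2:
  fixes h :: "(nat \<Rightarrow> 'h::real_inner) \<Rightarrow> real \<Rightarrow> real"
  assumes "(\<lambda>(\<sigma>, x). h \<sigma> x) \<in> borel_measurable (overlap_algebra J \<Otimes>\<^sub>M borel)"
    "\<And>i. i \<in> J \<Longrightarrow> \<sigma> i = \<tau> i"
  shows "h \<sigma> x = h \<tau> x"
proof (rule overlap_algebra_cong[where \<Psi> = "\<lambda>\<sigma>. h \<sigma> x", OF _ assms(2)])
  show "(\<lambda>\<sigma>. h \<sigma> x) \<in> borel_measurable (overlap_algebra J)"
    using measurable_compose[OF measurable_Pair2'[of x borel "overlap_algebra J"] assms(1)] by simp
qed

context random_measure
begin

lemma measurable_snd_overlap_algebra: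
  assumes "J \<subseteq> {1..}"
  shows "snd \<in> measurable (M \<Otimes>\<^sub>M replica_space) (overlap_algebra J :: (nat \<Rightarrow> 'h) measure)"
  by (rule measurable_compose[OF measurable_snd replica_space_to_overlap_algebra[OF assms]])

lemma bmI_overlap:
  assumes "bounded_measurable (overlap_algebra J) \<Psi>" "J \<subseteq> {1..}"
  shows "bm (\<lambda>\<omega> \<sigma>. \<Psi> \<sigma>)"
  by (rule bounded_measurable_compose[OF measurable_snd_overlap_algebra[OF assms(2)] assms(1)])

lemma measurable_pair_overlap:
  assumes "J \<subseteq> {1..}" "1 \<le> i" "1 \<le> j"
  shows "(\<lambda>x. (snd x, snd x i \<bullet> snd x j)) \<in> measurable (M \<Otimes>\<^sub>M replica_space)
           (overlap_algebra J \<Otimes>\<^sub>M borel :: ((nat \<Rightarrow> 'h) \<times> real) measure)"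
proof (rule measurable_Pair)
  show "snd \<in> measurable (M \<Otimes>\<^sub>M replica_space) (overlap_algebra J :: (nat \<Rightarrow> 'h) measure)"
    by (rule measurable_snd_overlap_algebra[OF assms(1)])
  have "i \<in> {1..}" "j \<in> {1..}" using assms by auto
  then show "(\<lambda>x. snd x i \<bullet> snd x j) \<in> borel_measurable (M \<Otimes>\<^sub>M rspace)"
    by measurable
qed

lemma bmI_overlap2:
  assumes "bounded_measurable (overlap_algebra J \<Otimes>\<^sub>M borel) (\<lambda>(\<sigma>, x). h \<sigma> x)"
    and "J \<subseteq> {1..}" "1 \<le> i" "1 \<le> j"
  shows "bm (\<lambda>\<omega> \<sigma>. h \<sigma> (\<sigma> i \<bullet> \<sigma> j))"
  using bounded_measurable_compose[OF measurable_pair_overlap[OF assms(2-4)] assms(1)] by simp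

lemma pair_kernel: "(\<lambda>\<omega>. G \<omega> \<Otimes>\<^sub>M G \<omega>) \<in> measurable M (prob_algebra (borel \<Otimes>\<^sub>M borel))"
  by measurable

lemma sets_overlap_law [simp, measurable_cong]: "sets (overlap_law M G) = sets borel"
  by (simp add: overlap_law_def)

lemma space_overlap_law [simp]: "space (overlap_law M G) = UNIV"
  by (simp add: overlap_law_def)

lemma sets_pair_bind: "sets (M \<bind> (\<lambda>\<omega>. G \<omega> \<Otimes>\<^sub>M G \<omega>)) = sets (borel \<Otimes>\<^sub>M borel)"
  by (rule sets_bind'[OF M_in_prob_algebra pair_kernel])

lemma measurable_inner_pair:
  "(\<lambda>(x, y). x \<bullet> y) \<in> borel_measurable (M \<bind> (\<lambda>\<omega>. G \<omega> \<Otimes>\<^sub>M G \<omega>))"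
  unfolding measurable_cong_sets[OF sets_pair_bind refl] by measurable

lemma prob_overlap_law: "prob_space (overlap_law M G)"
  unfolding overlap_law_def
  by (rule prob_space.prob_space_distr[OF prob_space_bind'[OF M_in_prob_algebra pair_kernel] measurable_inner_pair])

lemma integral_overlap_law:
  assumes \<psi>: "bounded_measurable borel \<psi>"
  shows "(\<integral>x. \<psi> x \<partial>overlap_law M G) = E_avg M G (\<lambda>\<omega> \<sigma>. \<psi> (\<sigma> 1 \<bullet> \<sigma> 2))"
proof -
  interpret prob_space M by (rule prob_M)
  obtain c where \<psi>m [measurable]: "\<psi> \<in> borel_measurable borel" and c0: "\<And>x. x \<in> space borel \<Longrightarrow> \<bar>\<psi> x\<bar> \<le> c"
    using bounded_measurableE[OF \<psi>] by metis
  have c: "\<bar>\<psi> x\<bar> \<le> c" for x using c0 by simp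
  have \<psi>i: "(\<lambda>(x, y). \<psi> (x \<bullet> y)) \<in> borel_measurable (borel \<Otimes>\<^sub>M borel :: ('h \<times> 'h) measure)"
    by measurable
  have "(\<integral>x. \<psi> x \<partial>overlap_law M G) = (\<integral>p. \<psi> (fst p \<bullet> snd p) \<partial>(M \<bind> (\<lambda>\<omega>. G \<omega> \<Otimes>\<^sub>M G \<omega>)))"
    unfolding overlap_law_def using measurable_inner_pair by (simp add: integral_distr split_beta')
  also have "\<dots> = (\<integral>\<omega>. (\<integral>p. \<psi> (fst p \<bullet> snd p) \<partial>(G \<omega> \<Otimes>\<^sub>M G \<omega>)) \<partial>M)"
  proof (rule integral_bind[where K = "borel \<Otimes>\<^sub>M borel" and B' = 1 and B = c])
    have "emeasure (G x \<Otimes>\<^sub>M G x) (space (G x \<Otimes>\<^sub>M G x)) \<le> ennreal 1" if "x \<in> space M" for x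
      using measurable_space[OF pair_kernel that] prob_space.emeasure_space_1
      by (fastforce simp: space_prob_algebra simp del: space_pair_measure)
    then show "AE x in M. emeasure (G x \<Otimes>\<^sub>M G x) (space (G x \<Otimes>\<^sub>M G x)) \<le> ennreal 1"
      by (auto intro!: AE_I2)
    show "(\<lambda>p. \<psi> (fst p \<bullet> snd p)) \<in> borel_measurable (borel \<Otimes>\<^sub>M borel :: ('h \<times> 'h) measure)"
      using \<psi>i by (simp add: split_beta')
  qed (use c pair_kernel finite_measure_axioms in \<open>auto intro: measurable_prob_algebraD\<close>)
  also have "\<dots> = (\<integral>\<omega>. (\<integral>s'. (\<integral>s. \<psi> (s' \<bullet> s) \<partial>G \<omega>) \<partial>G \<omega>) \<partial>M)"
  proof (rule Bochner_Integration.integral_cong[OF refl])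
    fix \<omega> assume \<omega>: "\<omega> \<in> space M"
    interpret G: prob_space "G \<omega>" by (rule prob_G[OF \<omega>])
    interpret GG: pair_prob_space "G \<omega>" "G \<omega>" ..
    note sG = sets_G[OF \<omega>]
    have "(\<lambda>(x, y). \<psi> (x \<bullet> y)) \<in> borel_measurable (G \<omega> \<Otimes>\<^sub>M G \<omega>)"
      unfolding measurable_cong_sets[OF sets_pair_measure_cong[OF sG sG] refl] by (rule \<psi>i)
    then have "integrable (G \<omega> \<Otimes>\<^sub>M G \<omega>) (\<lambda>(x, y). \<psi> (x \<bullet> y))"
      by (intro GG.integrable_const_bound[where B = c]) (auto intro: c)
    from GG.integral_fst[OF this]
    show "(\<integral>p. \<psi> (fst p \<bullet> snd p) \<partial>(G \<omega> \<Otimes>\<^sub>M G \<omega>)) = (\<integral>s'. (\<integral>s. \<psi> (s' \<bullet> s) \<partial>G \<omega>) \<partial>G \<omega>)"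
      by (simp add: split_beta')
  qed
  also have "\<dots> = E_avg M G (\<lambda>\<omega> \<sigma>. \<integral>s'. (\<integral>s. \<psi> (s' \<bullet> s) \<partial>G \<omega>) \<partial>G \<omega>)"
    unfolding E_avg_def
    by (intro Bochner_Integration.integral_cong refl)
       (use prob_space.prob_space[OF prob_replicas] in \<open>simp add: replicas_def\<close>)
  also have "\<dots> = E_avg M G (\<lambda>\<omega> \<sigma>. \<integral>s. \<psi> (\<sigma> 1 \<bullet> s) \<partial>G \<omega>)"
  proof (rule E_avg_fresh_replica)
    show "bounded_measurable ((M \<Otimes>\<^sub>M replica_space) \<Otimes>\<^sub>M borel)
        (\<lambda>x. \<integral>s. \<psi> (snd x \<bullet> s) \<partial>G (fst (fst x)))"
      by (rule bounded_measurable_integral_G)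
         (auto simp: split_beta' intro!: bounded_measurableI[where c = c] c)
  qed auto
  also have "\<dots> = E_avg M G (\<lambda>\<omega> \<sigma>. \<psi> (\<sigma> 1 \<bullet> \<sigma> 2))"
  proof (rule E_avg_fresh_replica)
    have "1 \<in> {1::nat..}" by simp
    then have "(\<lambda>x. \<psi> (snd (fst x) 1 \<bullet> snd x)) \<in> borel_measurable ((M \<Otimes>\<^sub>M rspace) \<Otimes>\<^sub>M borel)"
      by measurable
    then show "bounded_measurable ((M \<Otimes>\<^sub>M rspace) \<Otimes>\<^sub>M borel) (\<lambda>x. \<psi> (snd (fst x) 1 \<bullet> snd x))"
      by (rule bounded_measurableI) (rule c)
  qed auto
  finally show ?thesis .
qed

end

section \<open>The Ghirlanda-Guerra identities for jointly measurable functions\<close>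

locale ghirlanda_guerra_measure = random_measure M G
  for M :: "'w measure"
    and G :: "'w \<Rightarrow> 'h::{real_inner, complete_space, second_countable_topology} measure" +
  assumes gg: "ghirlanda_guerra M G"
begin

abbreviation \<mu> :: "real measure" where "\<mu> \<equiv> overlap_law M G"

lemma bounded_measurable_integral_overlap_law:
  fixes h :: "(nat \<Rightarrow> 'h) \<Rightarrow> real \<Rightarrow> real"
  assumes "bounded_measurable (overlap_algebra J \<Otimes>\<^sub>M borel) (\<lambda>(\<sigma>, x). h \<sigma> x)"
  shows "bounded_measurable (overlap_algebra J) (\<lambda>\<sigma>. \<integral>x. h \<sigma> x \<partial>\<mu>)"
proof -
  interpret \<mu>: prob_space \<mu> by (rule prob_overlap_law)
  obtain c where hm: "(\<lambda>(\<sigma>, x). h \<sigma> x) \<in> borel_measurable (overlap_algebra J \<Otimes>\<^sub>M borel)"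
    and c0: "\<And>z. z \<in> space (overlap_algebra J \<Otimes>\<^sub>M borel) \<Longrightarrow> \<bar>case z of (\<sigma>, x) \<Rightarrow> h \<sigma> x\<bar> \<le> c"
    using bounded_measurableE[OF assms] by metis
  have c: "\<bar>h \<sigma> x\<bar> \<le> c" for \<sigma> x
    using c0[of "(\<sigma>, x)"] by (simp add: space_pair_measure)
  have hm2: "(\<lambda>(\<sigma>, x). h \<sigma> x) \<in> borel_measurable (overlap_algebra J \<Otimes>\<^sub>M \<mu>)"
    using hm unfolding measurable_cong_sets[OF sets_pair_measure_cong[OF refl sets_overlap_law] refl] .
  show ?thesis
  proof (rule bounded_measurableI[OF \<mu>.borel_measurable_lebesgue_integral[OF hm2]])
    fix \<sigma>
    show "\<bar>\<integral>x. h \<sigma> x \<partial>\<mu>\<bar> \<le> c"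
      using measurable_compose[OF measurable_Pair1'[of \<sigma> "overlap_algebra J" \<mu>] hm2]
      by (intro \<mu>.abs_integral_le c) simp
  qed
qed

text \<open>The identities for products f psi extend to jointly measurable functions h. They say
  that, given the overlaps of the first n replicas, the overlap of replicas 1 and n + 1 is distributed as an even mixture of its law and of point masses at the
  overlaps of replica 1 with the replicas 2, ..., n. Up to the factor n, both sides are therefore
  integrals of h against probability measures on a product space, and these agree on rectangles.\<close>

lemma ghirlanda_guerra_mixture:
  fixes h :: "(nat \<Rightarrow> 'h) \<Rightarrow> real \<Rightarrow> real"
  assumes n: "2 \<le> n"
    and h: "bounded_measurable (overlap_algebra {1..n} \<Otimes>\<^sub>M borel) (\<lambda>(\<sigma>, x). h \<sigma> x)"
  shows "real n * E_avg M G (\<lambda>\<omega> \<sigma>. h \<sigma> (\<sigma> 1 \<bullet> \<sigma> (n + 1)))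
       = E_avg M G (\<lambda>\<omega> \<sigma>. \<integral>x. h \<sigma> x \<partial>\<mu>) + (\<Sum>l = 2..n. E_avg M G (\<lambda>\<omega> \<sigma>. h \<sigma> (\<sigma> 1 \<bullet> \<sigma> l)))"
proof -
  let ?J = "{1..n}"
  let ?O = "overlap_algebra ?J :: (nat \<Rightarrow> 'h) measure"
  have J: "?J \<subseteq> {1..}" by auto
  interpret P: prob_space joint_law by (rule prob_joint_law)
  interpret \<mu>: prob_space \<mu> by (rule prob_overlap_law)
  have snd_m: "snd \<in> measurable joint_law ?O"
    unfolding measurable_cong_sets[OF sets_joint_law refl]
    by (rule measurable_snd_overlap_algebra[OF J])
  interpret O: prob_space "distr joint_law ?O snd" by (rule P.prob_space_distr[OF snd_m])
  interpret O\<mu>: pair_prob_space "distr joint_law ?O snd" \<mu> ..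
  \<comment> \<open>The components of the mixture: independent sampling from the overlap law takes index 1.\<close>
  define L where "L l = (if l = 1 then distr joint_law ?O snd \<Otimes>\<^sub>M \<mu>
      else distr joint_law (?O \<Otimes>\<^sub>M borel) (\<lambda>z. (snd z, snd z 1 \<bullet> snd z l)))" for l
  have pair_m: "(\<lambda>z. (snd z, snd z 1 \<bullet> snd z l)) \<in> measurable joint_law (?O \<Otimes>\<^sub>M borel)"
    if "1 \<le> l" for l
    unfolding measurable_cong_sets[OF sets_joint_law refl]
    by (rule measurable_pair_overlap[OF J _ that]) simp
  have sets_L: "sets (L l) = sets (?O \<Otimes>\<^sub>M borel)" for l
    by (auto simp: L_def intro!: sets_pair_measure_cong)
  have prob_L: "prob_space (L l)" if "1 \<le> l" for l
    unfolding L_def using P.prob_space_distr[OF pair_m[OF that]] O\<mu>.prob_space_axioms by simp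
  have int_L: "(\<integral>z. k (fst z) (snd z) \<partial>L l) = E_avg M G (\<lambda>\<omega> \<sigma>. k \<sigma> (\<sigma> 1 \<bullet> \<sigma> l))"
    if "bounded_measurable (?O \<Otimes>\<^sub>M borel) (\<lambda>(\<sigma>, x). k \<sigma> x)" "2 \<le> l" for k l
  proof -
    have "(\<integral>z. k (fst z) (snd z) \<partial>L l) = (\<integral>z. k (snd z) (snd z 1 \<bullet> snd z l) \<partial>joint_law)"
      using that by (simp add: L_def integral_distr[OF pair_m] bounded_measurable_def split_beta')
    also have "\<dots> = E_avg M G (\<lambda>\<omega> \<sigma>. k \<sigma> (\<sigma> 1 \<bullet> \<sigma> l))"
      by (rule E_avg_eq_joint_law[symmetric, where g = "\<lambda>\<omega> \<sigma>. k \<sigma> (\<sigma> 1 \<bullet> \<sigma> l)"])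
         (use that J in \<open>auto intro!: bmI_overlap2\<close>)
    finally show ?thesis .
  qed
  have int_L1: "(\<integral>z. k (fst z) (snd z) \<partial>L 1) = E_avg M G (\<lambda>\<omega> \<sigma>. \<integral>x. k \<sigma> x \<partial>\<mu>)"
    if k: "bounded_measurable (?O \<Otimes>\<^sub>M borel) (\<lambda>(\<sigma>, x). k \<sigma> x)" for k
  proof -
    obtain c where km: "(\<lambda>(\<sigma>, x). k \<sigma> x) \<in> borel_measurable (?O \<Otimes>\<^sub>M borel)" and c0: "\<And>z. z \<in> space (?O \<Otimes>\<^sub>M borel) \<Longrightarrow> \<bar>case z of (\<sigma>, x) \<Rightarrow> k \<sigma> x\<bar> \<le> c"
      using bounded_measurableE[OF k] by metis
    have c: "\<bar>k \<sigma> x\<bar> \<le> c" for \<sigma> x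
      using c0[of "(\<sigma>, x)"] by (simp add: space_pair_measure)
    have km1: "(\<lambda>(\<sigma>, x). k \<sigma> x) \<in> borel_measurable (distr joint_law ?O snd \<Otimes>\<^sub>M \<mu>)"
      using km unfolding measurable_cong_sets[OF sets_pair_measure_cong[OF sets_distr sets_overlap_law] refl] .
    have km2: "(\<lambda>(\<sigma>, x). k \<sigma> x) \<in> borel_measurable (?O \<Otimes>\<^sub>M \<mu>)"
      using km unfolding measurable_cong_sets[OF sets_pair_measure_cong[OF refl sets_overlap_law] refl] .
    have "integrable (distr joint_law ?O snd \<Otimes>\<^sub>M \<mu>) (\<lambda>(\<sigma>, x). k \<sigma> x)"
      by (rule O\<mu>.integrable_const_bound[where B = c]) (use km1 c in auto)
    from O\<mu>.integral_fst[OF this]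
    have "(\<integral>z. k (fst z) (snd z) \<partial>L 1) = (\<integral>\<sigma>. (\<integral>x. k \<sigma> x \<partial>\<mu>) \<partial>distr joint_law ?O snd)"
      by (simp add: L_def split_beta')
    also have im: "(\<lambda>\<sigma>. \<integral>x. k \<sigma> x \<partial>\<mu>) \<in> borel_measurable ?O"
      using \<mu>.borel_measurable_lebesgue_integral[OF km2] .
    have "(\<integral>\<sigma>. (\<integral>x. k \<sigma> x \<partial>\<mu>) \<partial>distr joint_law ?O snd) = (\<integral>z. (\<integral>x. k (snd z) x \<partial>\<mu>) \<partial>joint_law)"
      by (rule integral_distr[OF snd_m im])
    also have "\<dots> = E_avg M G (\<lambda>\<omega> \<sigma>. \<integral>x. k \<sigma> x \<partial>\<mu>)"
      by (rule E_avg_eq_joint_law[symmetric, where g = "\<lambda>\<omega> \<sigma>. \<integral>x. k \<sigma> x \<partial>\<mu>"],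
          rule bmI_overlap[OF bounded_measurable_integral_overlap_law[OF k] J])
    finally show ?thesis .
  qed

  let ?p = "pmf_of_set {1..n}"
  have fin: "finite {1..n}" "{1..n} \<noteq> {}" using n by auto
  \<comment> \<open>The maximum only makes the components probability measures at the irrelevant index 0 too.\<close>
  define R where "R = measure_pmf ?p \<bind> (\<lambda>l. L (max 1 l))"
  have kern: "(\<lambda>l. L (max 1 l)) \<in> measurable (measure_pmf ?p) (prob_algebra (?O \<Otimes>\<^sub>M borel))"
    by (auto simp: measurable_pmf_measure1 space_prob_algebra sets_L intro!: prob_L)
  have p_in: "measure_pmf ?p \<in> space (prob_algebra (measure_pmf ?p))"
    by (simp add: space_prob_algebra measure_pmf.prob_space_axioms)
  have sets_R: "sets R = sets (?O \<Otimes>\<^sub>M borel)"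
    unfolding R_def by (rule sets_bind'[OF p_in kern])
  have prob_R: "prob_space R"
    unfolding R_def by (rule prob_space_bind'[OF p_in kern])
  have int_R: "real n * (\<integral>z. k (fst z) (snd z) \<partial>R) = E_avg M G (\<lambda>\<omega> \<sigma>. \<integral>x. k \<sigma> x \<partial>\<mu>)
       + (\<Sum>l = 2..n. E_avg M G (\<lambda>\<omega> \<sigma>. k \<sigma> (\<sigma> 1 \<bullet> \<sigma> l)))"
    if k: "bounded_measurable (?O \<Otimes>\<^sub>M borel) (\<lambda>(\<sigma>, x). k \<sigma> x)" for k
  proof -
    obtain c where km': "(\<lambda>(\<sigma>, x). k \<sigma> x) \<in> borel_measurable (?O \<Otimes>\<^sub>M borel)"
      and c0: "\<And>z. z \<in> space (?O \<Otimes>\<^sub>M borel) \<Longrightarrow> \<bar>case z of (\<sigma>, x) \<Rightarrow> k \<sigma> x\<bar> \<le> c"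
      using bounded_measurableE[OF k] by metis
    from km' have km: "(\<lambda>z. k (fst z) (snd z)) \<in> borel_measurable (?O \<Otimes>\<^sub>M borel)"
      by (simp add: split_beta')
    have c: "\<bar>k \<sigma> x\<bar> \<le> c" for \<sigma> x
      using c0[of "(\<sigma>, x)"] by (simp add: space_pair_measure)
    have "(\<integral>z. k (fst z) (snd z) \<partial>R) = (\<integral>l. (\<integral>z. k (fst z) (snd z) \<partial>L (max 1 l)) \<partial>measure_pmf ?p)"
      unfolding R_def
    proof (rule integral_bind[where K = "?O \<Otimes>\<^sub>M borel" and B' = 1 and B = c])
      show "AE l in measure_pmf ?p. emeasure (L (max 1 l)) (space (L (max 1 l))) \<le> ennreal 1"
        by (rule AE_I2) (simp add: prob_space.emeasure_space_1[OF prob_L])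
    qed (use km c measurable_prob_algebraD[OF kern] measure_pmf.finite_measure_axioms in auto)
    also have "\<dots> = (\<Sum>l\<in>{1..n}. \<integral>z. k (fst z) (snd z) \<partial>L (max 1 l)) / real n"
      by (subst integral_pmf_of_set) (use fin in auto)
    also have "{1..n} = insert 1 {2..n}" using n by auto
    finally have "real n * (\<integral>z. k (fst z) (snd z) \<partial>R)
        = (\<integral>z. k (fst z) (snd z) \<partial>L 1) + (\<Sum>l\<in>{2..n}. \<integral>z. k (fst z) (snd z) \<partial>L (max 1 l))"
      using n by simp
    also have "(\<Sum>l\<in>{2..n}. \<integral>z. k (fst z) (snd z) \<partial>L (max 1 l))
        = (\<Sum>l\<in>{2..n}. E_avg M G (\<lambda>\<omega> \<sigma>. k \<sigma> (\<sigma> 1 \<bullet> \<sigma> l)))"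
      by (rule sum.cong) (auto simp: int_L[OF k] max_def)
    finally show ?thesis by (simp add: int_L1[OF k])
  qed

  have "L (n + 1) = R"
  proof (rule measure_eqI_generator_eq[where E = "{a \<times> b | a b. a \<in> sets ?O \<and> b \<in> sets borel}"
        and \<Omega> = "space ?O \<times> space borel" and A = "\<lambda>_. UNIV"])
    fix C assume "C \<in> {a \<times> b | a b. a \<in> sets ?O \<and> b \<in> sets (borel :: real measure)}"
    then obtain a b where C: "C = a \<times> b" and a: "a \<in> sets ?O" and b: "b \<in> sets (borel :: real measure)"
      by auto
    from a obtain a' where a': "a' \<in> sets (\<Pi>\<^sub>M a\<in>?J \<times> ?J. borel)" and aa': "a = overlaps (?J \<times> ?J) -` a'"
      unfolding overlap_algebra_def
      by (subst (asm) sets_vimage_algebra2) (use overlaps_in_space in auto)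
    have CO: "C \<in> sets (?O \<Otimes>\<^sub>M borel)" using a b C by auto
    let ?k = "\<lambda>\<sigma> x. indicator a \<sigma> * indicator b x :: real"
    have k: "bounded_measurable (?O \<Otimes>\<^sub>M borel) (\<lambda>(\<sigma>, x). ?k \<sigma> x)"
      by (rule bounded_measurableI[where c = 1]) (use a b in \<open>auto split: split_indicator\<close>)
    have meas: "measure N C = (\<integral>z. ?k (fst z) (snd z) \<partial>N)"
      if "sets N = sets (?O \<Otimes>\<^sub>M borel)" for N :: "((nat \<Rightarrow> 'h) \<times> real) measure"
    proof -
      have "measure N C = (\<integral>z. indicator C z \<partial>N)"
        using CO that sets.sets_into_space by (simp add: Int_absorb2)
      also have "\<dots> = (\<integral>z. ?k (fst z) (snd z) \<partial>N)"
        by (intro Bochner_Integration.integral_cong) (auto simp: C indicator_times)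
      finally show ?thesis .
    qed
    have f: "bounded_measurable (\<Pi>\<^sub>M a\<in>?J \<times> ?J. borel) (indicator a' :: _ \<Rightarrow> real)"
      by (rule bounded_measurableI[where c = 1]) (use a' in \<open>auto split: split_indicator\<close>)
    have \<psi>: "bounded_measurable borel (indicator b :: _ \<Rightarrow> real)"
      by (rule bounded_measurableI[where c = 1]) (use b in \<open>auto split: split_indicator\<close>)
    have ind: "indicator a' (overlaps (?J \<times> ?J) \<sigma>) = (indicator a \<sigma> :: real)" for \<sigma> :: "nat \<Rightarrow> 'h"
      by (simp add: aa' indicator_def)
    have gg1: "E_avg M G (\<lambda>\<omega> \<sigma>. ?k \<sigma> (\<sigma> 1 \<bullet> \<sigma> (n + 1)))
        = 1 / real n * E_avg M G (\<lambda>\<omega> \<sigma>. indicator a \<sigma>) * (\<integral>x. indicator b x \<partial>\<mu>)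
          + 1 / real n * (\<Sum>l = 2..n. E_avg M G (\<lambda>\<omega> \<sigma>. ?k \<sigma> (\<sigma> 1 \<bullet> \<sigma> l)))"
      using gg[unfolded ghirlanda_guerra_def, rule_format, OF n f \<psi>] integral_overlap_law[OF \<psi>]
      by (simp only: ind)
    have gg2: "E_avg M G (\<lambda>\<omega> \<sigma>. indicator a \<sigma>) * (\<integral>x. indicator b x \<partial>\<mu>)
        = E_avg M G (\<lambda>\<omega> \<sigma>. \<integral>x. ?k \<sigma> x \<partial>\<mu>)"
      by (simp add: E_avg_cmult[symmetric] mult.commute)
    have "real n * E_avg M G (\<lambda>\<omega> \<sigma>. ?k \<sigma> (\<sigma> 1 \<bullet> \<sigma> (n + 1))) = real n * (\<integral>z. ?k (fst z) (snd z) \<partial>R)"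
      unfolding gg1 mult.assoc gg2 int_R[OF k] using n by (simp add: distrib_left)
    then have "measure (L (n + 1)) C = measure R C"
      using n int_L[OF k, of "n + 1"] by (simp add: meas[OF sets_L] meas[OF sets_R])
    then show "emeasure (L (n + 1)) C = emeasure R C"
      using prob_L[of "n + 1"] prob_R
      by (simp add: finite_measure.emeasure_eq_measure prob_space.finite_measure)
  next
    show "Int_stable {a \<times> b | a b. a \<in> sets ?O \<and> b \<in> sets (borel :: real measure)}"
      by (rule Int_stable_pair_measure_generator)
    show "{a \<times> b | a b. a \<in> sets ?O \<and> b \<in> sets (borel :: real measure)} \<subseteq> Pow (space ?O \<times> space borel)"
      by auto
    show "sets (L (n + 1)) = sigma_sets (space ?O \<times> space borel) {a \<times> b | a b. a \<in> sets ?O \<and> b \<in> sets borel}"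
      by (simp add: sets_L sets_pair_measure)
    show "sets R = sigma_sets (space ?O \<times> space borel) {a \<times> b | a b. a \<in> sets ?O \<and> b \<in> sets borel}"
      by (simp add: sets_R sets_pair_measure)
    show "range (\<lambda>_::nat. UNIV) \<subseteq> {a \<times> b | a b. a \<in> sets ?O \<and> b \<in> sets (borel :: real measure)}"
      using sets.top[of ?O] sets.top[of "borel :: real measure"] by (force simp del: sets.top)
    show "emeasure (L (n + 1)) UNIV \<noteq> \<infinity>"
      using prob_space.finite_measure[OF prob_L[of "n + 1"]]
      by (simp add: finite_measure.emeasure_eq_measure)
  qed auto
  then show ?thesis
    using int_R[OF h] int_L[OF h, of "n + 1"] n by simp
qed

text \<open>By exchangeability, replicas 1, ..., n may be replaced by N + 1, ..., N + m, and the
  distinguished replica by any l among these.\<close>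

lemma ghirlanda_guerra_shifted:
  fixes h :: "(nat \<Rightarrow> 'h) \<Rightarrow> real \<Rightarrow> real"
  assumes m: "2 \<le> m" and l: "l \<in> {N + 1..N + m}"
    and h: "bounded_measurable (overlap_algebra {N + 1..N + m} \<Otimes>\<^sub>M borel) (\<lambda>(\<sigma>, x). h \<sigma> x)"
  shows "real m * E_avg M G (\<lambda>\<omega> \<sigma>. h \<sigma> (\<sigma> l \<bullet> \<sigma> (N + m + 1)))
       = E_avg M G (\<lambda>\<omega> \<sigma>. \<integral>x. h \<sigma> x \<partial>\<mu>)
         + (\<Sum>l'\<in>{N + 1..N + m} - {l}. E_avg M G (\<lambda>\<omega> \<sigma>. h \<sigma> (\<sigma> l \<bullet> \<sigma> l')))"
proof -
  let ?J = "{N + 1..N + m}"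
  \<comment> \<open>A shift by N followed by the transposition that sends the image of 1 to l; its inverse on
    N + 1, ..., N + m is the map defined next.\<close>
  define \<pi> where "\<pi> i = Transposition.transpose (N + 1) l (N + i)" for i
  define \<rho> where "\<rho> i = Transposition.transpose (N + 1) l i - N" for i
  define h' where "h' \<tau> x = h (\<lambda>i. \<tau> (\<rho> i)) x" for \<tau> :: "nat \<Rightarrow> 'h" and x
  have \<rho>: "\<rho> i \<in> {1..m}" "\<pi> (\<rho> i) = i" if "i \<in> ?J" for i
    using that l by (auto simp: \<rho>_def \<pi>_def Transposition.transpose_def)
  have inj: "inj_on \<pi> {1..}"
    by (auto simp: \<pi>_def inj_on_def dest: injD[OF bij_is_inj[OF bij_transpose]])
  have range: "\<pi> \<in> {1..} \<rightarrow> {1..}"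
    using l by (auto simp: \<pi>_def Transposition.transpose_def)
  have h'_meas: "bounded_measurable (overlap_algebra {1..m} \<Otimes>\<^sub>M borel) (\<lambda>(\<sigma>, x). h' \<sigma> x)"
  proof -
    have "(\<lambda>\<tau>. \<lambda>i. \<tau> (\<rho> i)) \<in> measurable (overlap_algebra {1..m}) (overlap_algebra ?J :: (nat \<Rightarrow> 'h) measure)"
      by (intro measurable_to_overlap_algebra measurable_inner_overlap_algebra \<rho>)
    then have "(\<lambda>(\<tau>, x). (\<lambda>i. \<tau> (\<rho> i), x)) \<in> measurable (overlap_algebra {1..m} \<Otimes>\<^sub>M borel)
        (overlap_algebra ?J \<Otimes>\<^sub>M borel :: ((nat \<Rightarrow> 'h) \<times> real) measure)"
      by measurable
    from bounded_measurable_compose[OF this h] show ?thesis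
      by (simp add: h'_def split_beta')
  qed
  define \<theta> :: "(nat \<Rightarrow> 'h) \<Rightarrow> nat \<Rightarrow> 'h" where "\<theta> \<sigma> = (\<lambda>i\<in>{1..}. \<sigma> (\<pi> i))" for \<sigma>
  have h'_\<theta>: "h' (\<theta> \<sigma>) x = h \<sigma> x" for \<sigma> x
    unfolding h'_def
    by (rule overlap_algebra_cong2[where J = ?J])
       (use h \<rho> in \<open>auto simp: bounded_measurable_def \<theta>_def Pi_iff\<close>)
  have reindex: "E_avg M G (\<lambda>\<omega> \<sigma>. h' \<sigma> (\<sigma> 1 \<bullet> \<sigma> i)) = E_avg M G (\<lambda>\<omega> \<sigma>. h \<sigma> (\<sigma> l \<bullet> \<sigma> (\<pi> i)))"
    if "1 \<le> i" for i
  proof -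
    have "bm (\<lambda>\<omega> \<sigma>. h' \<sigma> (\<sigma> 1 \<bullet> \<sigma> i))"
      by (rule bmI_overlap2[OF h'_meas]) (use that in auto)
    from E_avg_reindex[OF this inj range, folded \<theta>_def]
    have "E_avg M G (\<lambda>\<omega> \<sigma>. h' \<sigma> (\<sigma> 1 \<bullet> \<sigma> i)) = E_avg M G (\<lambda>\<omega> \<sigma>. h \<sigma> (\<theta> \<sigma> 1 \<bullet> \<theta> \<sigma> i))"
      by (simp add: h'_\<theta>)
    moreover have "\<pi> 1 = l" by (simp add: \<pi>_def)
    ultimately show ?thesis using that by (simp add: \<theta>_def)
  qed
  have reindex1: "E_avg M G (\<lambda>\<omega> \<sigma>. \<integral>x. h' \<sigma> x \<partial>\<mu>) = E_avg M G (\<lambda>\<omega> \<sigma>. \<integral>x. h \<sigma> x \<partial>\<mu>)"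
  proof -
    have "bm (\<lambda>\<omega> \<sigma>. \<integral>x. h' \<sigma> x \<partial>\<mu>)"
      by (rule bmI_overlap[OF bounded_measurable_integral_overlap_law[OF h'_meas]]) auto
    from E_avg_reindex[OF this inj range, folded \<theta>_def] show ?thesis
      by (simp add: h'_\<theta>)
  qed
  have last: "\<pi> (m + 1) = N + m + 1"
    using l by (auto simp: \<pi>_def Transposition.transpose_def)
  have bij: "bij_betw \<pi> {2..m} (?J - {l})"
  proof (rule bij_betwI[where g = \<rho>])
    show "\<pi> \<in> {2..m} \<rightarrow> ?J - {l}" "\<rho> \<in> ?J - {l} \<rightarrow> {2..m}"
      using l by (auto simp: \<pi>_def \<rho>_def Transposition.transpose_def split: if_splits)
    show "\<rho> (\<pi> i) = i" for i by (simp add: \<pi>_def \<rho>_def)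
    show "\<pi> (\<rho> i) = i" if "i \<in> ?J - {l}" for i using \<rho> that by auto
  qed
  have "(\<Sum>i = 2..m. E_avg M G (\<lambda>\<omega> \<sigma>. h \<sigma> (\<sigma> l \<bullet> \<sigma> (\<pi> i))))
      = (\<Sum>l'\<in>?J - {l}. E_avg M G (\<lambda>\<omega> \<sigma>. h \<sigma> (\<sigma> l \<bullet> \<sigma> l')))"
    by (rule sum.reindex_bij_betw[OF bij])
  with ghirlanda_guerra_mixture[OF m h'_meas] show ?thesis
    by (simp add: reindex reindex1 last)
qed

end

section \<open>Tilting the random measure by one block of replicas\<close>

text \<open>The situation after some blocks have been processed. The first N replicas are used up: V is the
  density that they contribute, and A is the potential through which they tilt the random measure.
  Under these changes the law of the overlaps of the later replicas stays what it was.\<close>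

locale tilted_system = ghirlanda_guerra_measure M G
  for M :: "'w measure"
    and G :: "'w \<Rightarrow> 'h::{real_inner, complete_space, second_countable_topology} measure" +
  fixes N :: nat
    and V :: "'w \<Rightarrow> (nat \<Rightarrow> 'h) \<Rightarrow> real"
    and A :: "'h \<Rightarrow> (nat \<Rightarrow> 'h) \<Rightarrow> real"
    and v a :: real
  assumes V_meas: "(\<lambda>x. V (fst x) (snd x)) \<in> borel_measurable (M \<Otimes>\<^sub>M rspace)"
    and V_nonneg: "\<And>\<omega> \<sigma>. \<omega> \<in> space M \<Longrightarrow> \<sigma> \<in> space rspace \<Longrightarrow> 0 \<le> V \<omega> \<sigma>"
    and V_le: "\<And>\<omega> \<sigma>. \<omega> \<in> space M \<Longrightarrow> \<sigma> \<in> space rspace \<Longrightarrow> V \<omega> \<sigma> \<le> v"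
    and V_cong: "\<And>\<omega> \<sigma> \<tau>. (\<And>l. l \<in> {1..N} \<Longrightarrow> \<sigma> l = \<tau> l) \<Longrightarrow> V \<omega> \<sigma> = V \<omega> \<tau>"
    and A_meas: "(\<lambda>(\<sigma>, s). A s \<sigma>) \<in> borel_measurable (rspace \<Otimes>\<^sub>M borel)"
    and A_le: "\<And>s \<sigma>. \<bar>A s \<sigma>\<bar> \<le> a"
    and A_cong: "\<And>s \<sigma> \<tau>. (\<And>l. l \<in> {1..N} \<Longrightarrow> \<sigma> l = \<tau> l) \<Longrightarrow> A s \<sigma> = A s \<tau>"
    and tilt_invariance: "\<And>m \<Psi>. bounded_measurable (overlap_algebra {N + 1..N + m}) \<Psi> \<Longrightarrow>
          E_avg M G (\<lambda>\<omega> \<sigma>. V \<omega> \<sigma> * (\<Prod>l\<in>{N + 1..N + m}. exp (A (\<sigma> l) \<sigma>))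
              * inverse (\<integral>s. exp (A s \<sigma>) \<partial>G \<omega>) ^ m * \<Psi> \<sigma>)
          = E_avg M G (\<lambda>\<omega> \<sigma>. \<Psi> \<sigma>)"

text \<open>One further block of k replicas, with functions h that may depend on its overlaps.\<close>

locale block_tilt = tilted_system M G N V A v a
  for M :: "'w measure"
    and G :: "'w \<Rightarrow> 'h::{real_inner, complete_space, second_countable_topology} measure"
    and N V A v a +
  fixes k :: nat
    and h :: "nat \<Rightarrow> (nat \<Rightarrow> 'h) \<Rightarrow> real \<Rightarrow> real"
    and c :: real
  assumes h_meas: "\<And>l. l \<in> {N + 1..N + k} \<Longrightarrow>
          (\<lambda>(\<sigma>, x). h l \<sigma> x) \<in> borel_measurable (overlap_algebra {N + 1..N + k} \<Otimes>\<^sub>M borel)"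
    and h_le: "\<And>l \<sigma> x. l \<in> {N + 1..N + k} \<Longrightarrow> \<bar>h l \<sigma> x\<bar> \<le> c"
begin

text \<open>The replicas of the block.\<close>

abbreviation I :: "nat set" where "I \<equiv> {N + 1..N + k}"

text \<open>The first m replicas after those that are used up.\<close>

abbreviation J :: "nat \<Rightarrow> nat set" where "J m \<equiv> {N + 1..N + m}"

text \<open>The potential contributed by the block.\<close>

definition B :: "'h \<Rightarrow> (nat \<Rightarrow> 'h) \<Rightarrow> real" where
  "B s \<sigma> = (\<Sum>l\<in>I. h l \<sigma> (s \<bullet> \<sigma> l))"

text \<open>The potential of the block at its own replica l, where the interaction of l with itself is
  replaced by its mean under the overlap law; at replicas outside the block nothing is replaced.\<close>

definition B_at :: "nat \<Rightarrow> (nat \<Rightarrow> 'h) \<Rightarrow> real" where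
  "B_at l \<sigma> = B (\<sigma> l) \<sigma> + (if l \<in> I then (\<integral>x. h l \<sigma> x \<partial>\<mu>) - h l \<sigma> (\<sigma> l \<bullet> \<sigma> l) else 0)"

text \<open>The normalisation of the tilted measure, for a fraction t of the potential of the block, and
  its derivative in t.\<close>

definition Zt :: "real \<Rightarrow> 'w \<Rightarrow> (nat \<Rightarrow> 'h) \<Rightarrow> real" where
  "Zt t \<omega> \<sigma> = (\<integral>s. exp (A s \<sigma> + t * B s \<sigma>) \<partial>G \<omega>)"

definition Zt_deriv :: "real \<Rightarrow> 'w \<Rightarrow> (nat \<Rightarrow> 'h) \<Rightarrow> real" where
  "Zt_deriv t \<omega> \<sigma> = (\<integral>s. B s \<sigma> * exp (A s \<sigma> + t * B s \<sigma>) \<partial>G \<omega>)"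

text \<open>The joint density of the used-up replicas and of m further ones. The m replicas are tilted by
  A + t B, up to the replacement of the self-interactions.\<close>

definition dens :: "real \<Rightarrow> nat \<Rightarrow> 'w \<Rightarrow> (nat \<Rightarrow> 'h) \<Rightarrow> real" where
  "dens t m \<omega> \<sigma> = V \<omega> \<sigma> * (\<Prod>l\<in>J m. exp (A (\<sigma> l) \<sigma> + t * B_at l \<sigma>)) * inverse (Zt t \<omega> \<sigma>) ^ m"

text \<open>The tilted average at time t of a function of the first m replicas after the used-up ones. At
  t = 0 only A tilts; at t = 1 the whole potential of the block has been added.\<close>

definition T :: "real \<Rightarrow> nat \<Rightarrow> ((nat \<Rightarrow> 'h) \<Rightarrow> real) \<Rightarrow> real" where
  "T t m \<Psi> = E_avg M G (\<lambda>\<omega> \<sigma>. dens t m \<omega> \<sigma> * \<Psi> \<sigma>)"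

text \<open>The factor that comes down when the tilted average is differentiated in t. The subtracted
  term is the contribution of the normalisation, expressed by one more replica.\<close>

definition D :: "nat \<Rightarrow> (nat \<Rightarrow> 'h) \<Rightarrow> real" where
  "D m \<sigma> = (\<Sum>l\<in>J m. B_at l \<sigma>) - real m * B (\<sigma> (N + m + 1)) \<sigma>"

text \<open>A bound for the potential of the block, with or without replacement. The added 1 makes
  it positive.\<close>

definition L :: real where "L = (real k + 2) * \<bar>c\<bar> + 1"

lemma L_pos: "0 < L" by (simp add: L_def add_nonneg_pos)

lemma h_bdd: "l \<in> I \<Longrightarrow> bounded_measurable (overlap_algebra I \<Otimes>\<^sub>M borel) (\<lambda>(\<sigma>, x). h l \<sigma> x)"
  by (rule bounded_measurableI[OF h_meas, where c = c]) (use h_le in auto)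

lemma h_bdd_mono:
  assumes "l \<in> I" "I \<subseteq> K"
  shows "bounded_measurable (overlap_algebra K \<Otimes>\<^sub>M borel) (\<lambda>(\<sigma>, x). h l \<sigma> x)"
proof -
  have "(\<lambda>z. (fst z, snd z)) \<in> measurable (overlap_algebra K \<Otimes>\<^sub>M borel)
        (overlap_algebra I \<Otimes>\<^sub>M borel :: ((nat \<Rightarrow> 'h) \<times> real) measure)"
    by (rule measurable_Pair[OF measurable_compose[OF measurable_fst overlap_algebra_mono[OF assms(2)]]
          measurable_snd])
  from bounded_measurable_compose[OF this h_bdd[OF assms(1)]] show ?thesis by (simp add: split_beta')
qed

lemma h_cong: "l \<in> I \<Longrightarrow> (\<And>i. i \<in> I \<Longrightarrow> \<sigma> i = \<tau> i) \<Longrightarrow> h l \<sigma> x = h l \<tau> x"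
  by (rule overlap_algebra_cong2[OF h_meas]) auto

lemma h_mean_bdd:
  assumes "l \<in> I" "I \<subseteq> K"
  shows "bounded_measurable (overlap_algebra K) (\<lambda>\<sigma>. \<integral>x. h l \<sigma> x \<partial>\<mu>)"
  by (rule bounded_measurable_integral_overlap_law[OF h_bdd_mono[OF assms]])

lemma h_overlap_bdd:
  assumes "l \<in> I" "I \<subseteq> K" "i \<in> K" "j \<in> K"
  shows "bounded_measurable (overlap_algebra K) (\<lambda>\<sigma>. h l \<sigma> (\<sigma> i \<bullet> \<sigma> j))"
proof -
  have "(\<lambda>\<sigma>. (\<sigma>, \<sigma> i \<bullet> \<sigma> j)) \<in> measurable (overlap_algebra K)
        (overlap_algebra K \<Otimes>\<^sub>M borel :: ((nat \<Rightarrow> 'h) \<times> real) measure)"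
    by (rule measurable_Pair[OF measurable_ident measurable_inner_overlap_algebra, unfolded id_def])
       (use assms in auto)
  from bounded_measurable_compose[OF this h_bdd_mono[OF assms(1,2)]] show ?thesis by simp
qed

lemma B_bdd:
  assumes "I \<subseteq> K" "i \<in> K"
  shows "bounded_measurable (overlap_algebra K) (\<lambda>\<sigma>. B (\<sigma> i) \<sigma>)"
  unfolding B_def by (intro bounded_measurable_sum h_overlap_bdd) (use assms in auto)

lemma B_at_bdd:
  assumes "I \<subseteq> K" "i \<in> K"
  shows "bounded_measurable (overlap_algebra K) (B_at i)"
proof (cases "i \<in> I")
  case True
  then show ?thesis
    unfolding B_at_def using assms
    by (auto intro!: bounded_measurable_add bounded_measurable_diff B_bdd h_mean_bdd h_overlap_bdd)
next
  case False
  then have "B_at i = (\<lambda>\<sigma>. B (\<sigma> i) \<sigma>)" by (auto simp: B_at_def)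
  then show ?thesis using B_bdd[OF assms] by simp
qed

lemma D_bdd:
  assumes "k \<le> m"
  shows "bounded_measurable (overlap_algebra (J (Suc m))) (D m)"
  unfolding D_def
  by (intro bounded_measurable_diff bounded_measurable_sum bounded_measurable_mult
      bounded_measurable_const B_at_bdd B_bdd) (use assms in auto)

lemma abs_B_le: "\<bar>B s \<sigma>\<bar> \<le> real k * \<bar>c\<bar>"
proof -
  have "\<bar>B s \<sigma>\<bar> \<le> (\<Sum>l\<in>I. \<bar>h l \<sigma> (s \<bullet> \<sigma> l)\<bar>)"
    unfolding B_def by (rule sum_abs)
  also have "\<dots> \<le> (\<Sum>l\<in>I. \<bar>c\<bar>)"
    by (rule sum_mono) (use h_le in \<open>meson abs_ge_self order_trans\<close>)
  finally show ?thesis by simp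
qed

lemma abs_B_le_L: "\<bar>B s \<sigma>\<bar> \<le> L"
  using abs_B_le[of s \<sigma>] by (simp add: L_def algebra_simps)

lemma abs_B_at_le: "\<bar>B_at l \<sigma>\<bar> \<le> L"
proof (cases "l \<in> I")
  case True
  interpret \<mu>: prob_space \<mu> by (rule prob_overlap_law)
  have "\<bar>\<integral>x. h l \<sigma> x \<partial>\<mu>\<bar> \<le> c"
  proof (rule \<mu>.abs_integral_le)
    have "h l \<sigma> \<in> borel_measurable borel"
      using measurable_compose[OF measurable_Pair1'[of \<sigma> "overlap_algebra I" borel] h_meas[OF True]]
      by simp
    then show "h l \<sigma> \<in> borel_measurable \<mu>" by simp
  qed (rule h_le[OF True])
  with abs_B_le[of "\<sigma> l" \<sigma>] h_le[OF True, of \<sigma> "\<sigma> l \<bullet> \<sigma> l"] show ?thesis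
    by (simp add: B_at_def L_def True algebra_simps) (smt (verit))
next
  case False
  then have "B_at l \<sigma> = B (\<sigma> l) \<sigma>" unfolding B_at_def by (simp only: if_False add_0_right)
  then show ?thesis using abs_B_le_L[of "\<sigma> l" \<sigma>] by simp
qed

lemma abs_D_le: "\<bar>D m \<sigma>\<bar> \<le> 2 * L * real m"
proof -
  have "\<bar>\<Sum>l\<in>J m. B_at l \<sigma>\<bar> \<le> (\<Sum>l\<in>J m. L)"
    by (rule order_trans[OF sum_abs sum_mono]) (rule abs_B_at_le)
  moreover have "\<bar>real m * B (\<sigma> (N + m + 1)) \<sigma>\<bar> \<le> real m * L"
    by (simp add: abs_mult mult_left_mono abs_B_le_L)
  ultimately show ?thesis unfolding D_def by (simp add: algebra_simps)
qed

text \<open>Regrouped by the replicas l of the block, D consists of the terms of the Ghirlanda-Guerra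
  identity for l.\<close>

lemma D_eq:
  assumes "k \<le> m"
  shows "D m \<sigma> = (\<Sum>l\<in>I. (\<integral>x. h l \<sigma> x \<partial>\<mu>) + (\<Sum>l'\<in>J m - {l}. h l \<sigma> (\<sigma> l \<bullet> \<sigma> l'))
                     - real m * h l \<sigma> (\<sigma> l \<bullet> \<sigma> (N + m + 1)))"
proof -
  have IJ: "I \<subseteq> J m" using assms by auto
  have "(\<Sum>l'\<in>J m. if l' \<in> I then (\<integral>x. h l' \<sigma> x \<partial>\<mu>) - h l' \<sigma> (\<sigma> l' \<bullet> \<sigma> l') else 0)
      = (\<Sum>l\<in>I. (\<integral>x. h l \<sigma> x \<partial>\<mu>) - h l \<sigma> (\<sigma> l \<bullet> \<sigma> l))"
    using IJ by (subst sum.inter_restrict[symmetric]) (auto simp: Int_absorb1 simp del: atLeastAtMost_iff)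
  moreover have "(\<Sum>l'\<in>J m. B (\<sigma> l') \<sigma>) = (\<Sum>l\<in>I. \<Sum>l'\<in>J m. h l \<sigma> (\<sigma> l \<bullet> \<sigma> l'))"
    unfolding B_def by (subst sum.swap) (simp add: inner_commute)
  moreover have "(\<Sum>l\<in>I. \<Sum>l'\<in>J m. h l \<sigma> (\<sigma> l \<bullet> \<sigma> l'))
      = (\<Sum>l\<in>I. h l \<sigma> (\<sigma> l \<bullet> \<sigma> l) + (\<Sum>l'\<in>J m - {l}. h l \<sigma> (\<sigma> l \<bullet> \<sigma> l')))"
    by (intro sum.cong refl sum.remove) (use IJ in auto)
  ultimately show ?thesis
    unfolding D_def B_at_def B_def
    by (simp add: sum.distrib sum_subtractf sum_distrib_left inner_commute)
qed

text \<open>The Ghirlanda-Guerra identities say that D has mean zero against any bounded function of the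
  overlaps of the first m replicas.\<close>

lemma E_avg_D_eq_0:
  assumes m: "2 \<le> m" "k \<le> m" and \<Psi>: "bounded_measurable (overlap_algebra (J m)) \<Psi>"
  shows "E_avg M G (\<lambda>\<omega> \<sigma>. \<Psi> \<sigma> * D m \<sigma>) = 0"
proof -
  have IJ: "I \<subseteq> J m" and J1: "J i \<subseteq> {1..}" for i using m by auto
  define e where "e l l' \<sigma> = \<Psi> \<sigma> * h l \<sigma> (\<sigma> l \<bullet> \<sigma> l')" for l l' \<sigma>
  define e0 where "e0 l \<sigma> = \<Psi> \<sigma> * (\<integral>x. h l \<sigma> x \<partial>\<mu>)" for l \<sigma>
  have \<Psi>': "bounded_measurable (overlap_algebra (J (Suc m))) \<Psi>"
    by (rule bounded_measurable_compose[OF overlap_algebra_mono \<Psi>]) auto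
  have e_bm: "bm (\<lambda>\<omega>. e l l')" if "l \<in> I" "l' \<in> J (Suc m)" for l l'
    unfolding e_def using that m
    by (intro bmI_overlap[OF bounded_measurable_mult[OF \<Psi>' h_overlap_bdd] J1]) auto
  have e0_bm: "bm (\<lambda>\<omega>. e0 l)" if "l \<in> I" for l
    unfolding e0_def
    by (rule bmI_overlap[OF bounded_measurable_mult[OF \<Psi> h_mean_bdd[OF that IJ]] J1])
  have gg_l: "real m * E_avg M G (\<lambda>\<omega>. e l (N + m + 1)) = E_avg M G (\<lambda>\<omega>. e0 l)
       + (\<Sum>l'\<in>J m - {l}. E_avg M G (\<lambda>\<omega>. e l l'))" if l: "l \<in> I" for l
  proof -
    have "bounded_measurable (overlap_algebra (J m) \<Otimes>\<^sub>M borel) (\<lambda>(\<sigma>, x). \<Psi> \<sigma> * h l \<sigma> x)"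
      using bounded_measurable_mult[OF bounded_measurable_compose[OF measurable_fst \<Psi>] h_bdd_mono[OF l IJ]]
      by (simp add: split_beta')
    from ghirlanda_guerra_shifted[OF m(1) subsetD[OF IJ l] this] show ?thesis
      by (simp add: e_def[abs_def] e0_def[abs_def])
  qed
  have "E_avg M G (\<lambda>\<omega> \<sigma>. \<Psi> \<sigma> * D m \<sigma>)
      = E_avg M G (\<lambda>\<omega> \<sigma>. \<Sum>l\<in>I. e0 l \<sigma> + (\<Sum>l'\<in>J m - {l}. e l l' \<sigma>) - real m * e l (N + m + 1) \<sigma>)"
    by (intro E_avg_cong)
       (simp add: D_eq[OF m(2)] e_def e0_def sum_distrib_left algebra_simps)
  also have "\<dots> = (\<Sum>l\<in>I. E_avg M G (\<lambda>\<omega> \<sigma>. e0 l \<sigma> + (\<Sum>l'\<in>J m - {l}. e l l' \<sigma>) - real m * e l (N + m + 1) \<sigma>))"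
    by (intro E_avg_sum bounded_measurable_diff bounded_measurable_add bounded_measurable_sum
        bounded_measurable_mult bounded_measurable_const e_bm e0_bm) (use m in auto)
  also have "\<dots> = (\<Sum>l\<in>I. 0)"
  proof (rule sum.cong[OF refl])
    fix l assume l: "l \<in> I"
    have b1: "bm (\<lambda>\<omega> \<sigma>. e0 l \<sigma> + (\<Sum>l'\<in>J m - {l}. e l l' \<sigma>))"
      by (intro bounded_measurable_add bounded_measurable_sum e_bm e0_bm l) auto
    have b2: "bm (\<lambda>\<omega> \<sigma>. real m * e l (N + m + 1) \<sigma>)"
      by (intro bounded_measurable_mult bounded_measurable_const e_bm l) auto
    have b3: "bm (\<lambda>\<omega> \<sigma>. (\<Sum>l'\<in>J m - {l}. e l l' \<sigma>))"
      by (intro bounded_measurable_sum e_bm l) auto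
    have "E_avg M G (\<lambda>\<omega> \<sigma>. e0 l \<sigma> + (\<Sum>l'\<in>J m - {l}. e l l' \<sigma>) - real m * e l (N + m + 1) \<sigma>)
      = E_avg M G (\<lambda>\<omega>. e0 l) + (\<Sum>l'\<in>J m - {l}. E_avg M G (\<lambda>\<omega>. e l l')) - real m * E_avg M G (\<lambda>\<omega>. e l (N + m + 1))"
      unfolding E_avg_diff[OF b1 b2] E_avg_add[OF e0_bm[OF l] b3] E_avg_cmult
      by (subst E_avg_sum) (auto intro!: e_bm[OF l])
    then show "E_avg M G (\<lambda>\<omega> \<sigma>. e0 l \<sigma> + (\<Sum>l'\<in>J m - {l}. e l l' \<sigma>) - real m * e l (N + m + 1) \<sigma>) = 0"
      using gg_l[OF l] by simp
  qed
  finally show ?thesis by simp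
qed

subsection \<open>Integrability and dependence on finitely many replicas\<close>

lemma A_bdd: "bounded_measurable (rspace \<Otimes>\<^sub>M borel) (\<lambda>(\<sigma>, s). A s \<sigma>)"
  by (rule bounded_measurableI[OF A_meas]) (use A_le in auto)

lemma B_pair_bdd: "bounded_measurable (rspace \<Otimes>\<^sub>M borel) (\<lambda>(\<sigma>, s). B s \<sigma>)"
proof -
  have "bounded_measurable (rspace \<Otimes>\<^sub>M borel) (\<lambda>z. h l (fst z) (snd z \<bullet> fst z l))" if l: "l \<in> I" for l
  proof -
    from l have l1: "l \<in> {1..}" by auto
    have "(\<lambda>z. (fst z, snd z \<bullet> fst z l)) \<in> measurable (rspace \<Otimes>\<^sub>M borel)
        (overlap_algebra I \<Otimes>\<^sub>M borel :: ((nat \<Rightarrow> 'h) \<times> real) measure)"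
    proof (rule measurable_Pair)
      show "fst \<in> measurable (rspace \<Otimes>\<^sub>M borel) (overlap_algebra I :: (nat \<Rightarrow> 'h) measure)"
        by (rule measurable_compose[OF measurable_fst replica_space_to_overlap_algebra]) auto
      show "(\<lambda>z. snd z \<bullet> fst z l) \<in> borel_measurable (rspace \<Otimes>\<^sub>M borel)"
        using l1 by measurable
    qed
    from bounded_measurable_compose[OF this h_bdd[OF l]] show ?thesis by simp
  qed
  then show ?thesis
    unfolding B_def split_beta' by (rule bounded_measurable_sum)
qed

lemma weight_bdd: "bounded_measurable (rspace \<Otimes>\<^sub>M borel) (\<lambda>(\<sigma>, s). exp (A s \<sigma> + t * B s \<sigma>))"
  using bounded_measurable_exp[OF bounded_measurable_add[OF A_bdd
      bounded_measurable_mult[OF bounded_measurable_const B_pair_bdd]]]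
  by (simp add: split_beta')

lemma bm_integral_G:
  assumes "bounded_measurable (rspace \<Otimes>\<^sub>M borel) (\<lambda>(\<sigma>, s). q s \<sigma>)"
  shows "bm (\<lambda>\<omega> \<sigma>. \<integral>s. q s \<sigma> \<partial>G \<omega>)"
proof (rule bounded_measurable_integral_G[OF _ measurable_fst])
  have "(\<lambda>z. (snd (fst z), snd z)) \<in> measurable ((M \<Otimes>\<^sub>M rspace) \<Otimes>\<^sub>M borel) (rspace \<Otimes>\<^sub>M borel)"
    by measurable
  from bounded_measurable_compose[OF this assms]
  show "bounded_measurable ((M \<Otimes>\<^sub>M rspace) \<Otimes>\<^sub>M borel) (\<lambda>(z, s). q s (snd z))"
    by (simp add: split_beta')
qed

lemma measurable_G_section:
  assumes "bounded_measurable (rspace \<Otimes>\<^sub>M borel) (\<lambda>(\<sigma>, s). q s \<sigma>)" "\<omega> \<in> space M" "\<sigma> \<in> space rspace"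
  shows "(\<lambda>s. q s \<sigma>) \<in> borel_measurable (G \<omega>)"
proof -
  have "(\<lambda>s. q s \<sigma>) \<in> borel_measurable borel"
    using measurable_compose[OF measurable_Pair1'[OF assms(3)], of "\<lambda>(\<sigma>, s). q s \<sigma>"] assms(1)
    by (simp add: bounded_measurable_def)
  then show ?thesis by (simp only: measurable_cong_sets[OF sets_G[OF assms(2)] refl])
qed

text \<open>For times in the open interval from -2 to 2, all tilting weights lie between this constant and
  its inverse. The interval is chosen to contain the times from 0 to 1 in its interior, so that
  two-sided derivatives exist at the end points.\<close>

definition z0 :: real where "z0 = exp (- (a + 2 * L))"

lemma z0_pos: "0 < z0" by (simp add: z0_def)

lemma abs_exponent_le:
  assumes "\<bar>t\<bar> < 2" "\<bar>b\<bar> \<le> L"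
  shows "\<bar>A s \<sigma> + t * b\<bar> \<le> a + 2 * L"
proof -
  have "\<bar>t * b\<bar> \<le> 2 * L"
    unfolding abs_mult using assms by (intro mult_mono) auto
  then show ?thesis using A_le[of s \<sigma>] by linarith
qed

lemma Zt_bdd: "bm (Zt t)"
  unfolding Zt_def by (rule bm_integral_G[OF weight_bdd])

lemma Zt_deriv_bdd: "bm (Zt_deriv t)"
  unfolding Zt_deriv_def
  by (rule bm_integral_G) (use bounded_measurable_mult[OF B_pair_bdd weight_bdd] in \<open>simp add: split_beta'\<close>)

lemma weight_bounds:
  assumes "\<bar>t\<bar> < 2" "\<bar>b\<bar> \<le> L"
  shows "z0 \<le> exp (A s \<sigma> + t * b)" "exp (A s \<sigma> + t * b) \<le> inverse z0"
  using abs_exponent_le[OF assms, of s \<sigma>] by (auto simp: z0_def exp_minus[symmetric])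

lemma
  assumes t: "\<bar>t\<bar> < 2" and \<omega>: "\<omega> \<in> space M" and \<sigma>: "\<sigma> \<in> space rspace"
  shows Zt_ge: "z0 \<le> Zt t \<omega> \<sigma>"
    and Zt_deriv_le: "\<bar>Zt_deriv t \<omega> \<sigma>\<bar> \<le> L * Zt t \<omega> \<sigma>"
proof -
  interpret G: prob_space "G \<omega>" by (rule prob_G[OF \<omega>])
  have m: "(\<lambda>s. exp (A s \<sigma> + t * B s \<sigma>)) \<in> borel_measurable (G \<omega>)"
    by (rule measurable_G_section[OF weight_bdd \<omega> \<sigma>])
  have mB: "(\<lambda>s. B s \<sigma>) \<in> borel_measurable (G \<omega>)"
    by (rule measurable_G_section[OF B_pair_bdd \<omega> \<sigma>])
  have int: "integrable (G \<omega>) (\<lambda>s. exp (A s \<sigma> + t * B s \<sigma>))"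
    by (rule G.integrable_const_bound[where B = "inverse z0"])
       (use m weight_bounds(2)[OF t abs_B_le_L] in auto)
  then show "z0 \<le> Zt t \<omega> \<sigma>"
    unfolding Zt_def by (rule G.integral_ge_const) (use weight_bounds(1)[OF t abs_B_le_L] in auto)
  have "\<bar>Zt_deriv t \<omega> \<sigma>\<bar> \<le> (\<integral>s. \<bar>B s \<sigma> * exp (A s \<sigma> + t * B s \<sigma>)\<bar> \<partial>G \<omega>)"
    unfolding Zt_deriv_def by (rule integral_abs_bound)
  also have "\<dots> \<le> (\<integral>s. L * exp (A s \<sigma> + t * B s \<sigma>) \<partial>G \<omega>)"
  proof (rule integral_mono)
    show "integrable (G \<omega>) (\<lambda>s. L * exp (A s \<sigma> + t * B s \<sigma>))"
      using int by simp
    then show "integrable (G \<omega>) (\<lambda>s. \<bar>B s \<sigma> * exp (A s \<sigma> + t * B s \<sigma>)\<bar>)"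
      by (rule Bochner_Integration.integrable_bound)
         (use m mB L_pos in \<open>auto simp: abs_mult intro!: mult_right_mono abs_B_le_L\<close>)
  qed (auto simp: abs_mult intro!: mult_right_mono abs_B_le_L)
  finally show "\<bar>Zt_deriv t \<omega> \<sigma>\<bar> \<le> L * Zt t \<omega> \<sigma>" by (simp add: Zt_def)
qed

lemma Zt_pos: "\<bar>t\<bar> < 2 \<Longrightarrow> \<omega> \<in> space M \<Longrightarrow> \<sigma> \<in> space rspace \<Longrightarrow> 0 < Zt t \<omega> \<sigma>"
  using Zt_ge z0_pos by (meson less_le_trans)

lemma Zt_inverse_bdd: "\<bar>t\<bar> < 2 \<Longrightarrow> bm (\<lambda>\<omega> \<sigma>. inverse (Zt t \<omega> \<sigma>))"
  by (rule bounded_measurable_inverse[OF Zt_bdd z0_pos]) (auto simp: space_pair_measure intro!: Zt_ge)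

lemma Zt_has_real_derivative:
  assumes t: "\<bar>t\<bar> < 2" and \<omega>: "\<omega> \<in> space M" and \<sigma>: "\<sigma> \<in> space rspace"
  shows "((\<lambda>t. Zt t \<omega> \<sigma>) has_real_derivative Zt_deriv t \<omega> \<sigma>) (at t)"
proof -
  interpret G: prob_space "G \<omega>" by (rule prob_G[OF \<omega>])
  have m: "(\<lambda>s. exp (A s \<sigma> + t * B s \<sigma>)) \<in> borel_measurable (G \<omega>)" for t
    by (rule measurable_G_section[OF weight_bdd \<omega> \<sigma>])
  have mB: "(\<lambda>s. B s \<sigma>) \<in> borel_measurable (G \<omega>)"
    by (rule measurable_G_section[OF B_pair_bdd \<omega> \<sigma>])
  show ?thesis
    unfolding Zt_def Zt_deriv_def
  proof (rule G.has_real_derivative_integral[where a = "-2" and b = 2 and K = "L * inverse z0"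
        and g' = "\<lambda>t s. B s \<sigma> * exp (A s \<sigma> + t * B s \<sigma>)"])
    show "((\<lambda>t. exp (A s \<sigma> + t * B s \<sigma>)) has_real_derivative B s \<sigma> * exp (A s \<sigma> + t * B s \<sigma>)) (at t)" for s t
      by (auto intro!: derivative_eq_intros)
    show "integrable (G \<omega>) (\<lambda>s. exp (A s \<sigma> + t * B s \<sigma>))" if "t \<in> {-2<..<2}" for t
      by (rule G.integrable_const_bound[where B = "inverse z0"])
         (use m weight_bounds(2)[OF _ abs_B_le_L, of t] that in auto)
    show "\<bar>B s \<sigma> * exp (A s \<sigma> + t * B s \<sigma>)\<bar> \<le> L * inverse z0" if "t \<in> {-2<..<2}" for t s
      unfolding abs_mult
      by (rule mult_mono) (use abs_B_le_L weight_bounds(2)[OF _ abs_B_le_L, of t] that L_pos in auto)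
  qed (use t m mB in auto)
qed

lemma bm_at_replica:
  assumes "bounded_measurable (rspace \<Otimes>\<^sub>M borel) (\<lambda>(\<sigma>, s). q s \<sigma>)" "1 \<le> l"
  shows "bm (\<lambda>\<omega> \<sigma>. q (\<sigma> l) \<sigma>)"
proof -
  have "l \<in> {1..}" using assms(2) by simp
  then have "(\<lambda>z. (snd z, snd z l)) \<in> measurable (M \<Otimes>\<^sub>M rspace) (rspace \<Otimes>\<^sub>M borel)"
    by measurable
  from bounded_measurable_compose[OF this assms(1)] show ?thesis by simp
qed

lemma B_at_bm: "1 \<le> l \<Longrightarrow> bm (\<lambda>\<omega>. B_at l)"
  by (rule bmI_overlap[OF B_at_bdd[of "insert l I"]]) auto

lemma V_bdd: "bm V"
  by (rule bounded_measurableI[OF V_meas, where c = v]) (use V_nonneg V_le in \<open>auto simp: space_pair_measure\<close>)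

lemma dens_bdd:
  assumes "\<bar>t\<bar> < 2"
  shows "bm (dens t m)"
  unfolding dens_def
  by (intro bounded_measurable_mult bounded_measurable_prod bounded_measurable_exp
      bounded_measurable_add bounded_measurable_power bounded_measurable_const
      V_bdd B_at_bm bm_at_replica[OF A_bdd] Zt_inverse_bdd assms) auto

lemma dens_nonneg:
  assumes "\<bar>t\<bar> < 2" "\<omega> \<in> space M" "\<sigma> \<in> space rspace"
  shows "0 \<le> dens t m \<omega> \<sigma>"
  unfolding dens_def using V_nonneg[OF assms(2,3)] Zt_pos[OF assms]
  by (intro mult_nonneg_nonneg prod_nonneg zero_le_power) auto

lemma dens_le:
  assumes "\<bar>t\<bar> < 2" "\<omega> \<in> space M" "\<sigma> \<in> space rspace"
  shows "dens t m \<omega> \<sigma> \<le> v * inverse z0 ^ m * inverse z0 ^ m"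
proof -
  have "(\<Prod>l\<in>J m. exp (A (\<sigma> l) \<sigma> + t * B_at l \<sigma>)) \<le> (\<Prod>l\<in>J m. inverse z0)"
    by (rule prod_mono) (use weight_bounds(2)[OF assms(1) abs_B_at_le] in auto)
  moreover have "inverse (Zt t \<omega> \<sigma>) ^ m \<le> inverse z0 ^ m"
    using Zt_ge[OF assms] z0_pos Zt_pos[OF assms] by (intro power_mono le_imp_inverse_le) auto
  moreover have "0 \<le> v" using V_nonneg[OF assms(2,3)] V_le[OF assms(2,3)] by (rule order_trans)
  ultimately show ?thesis
    unfolding dens_def using V_le[OF assms(2,3)] V_nonneg[OF assms(2,3)] Zt_pos[OF assms] z0_pos
    by (intro mult_mono) (auto intro!: prod_nonneg mult_nonneg_nonneg)
qed

lemma B_cong: "(\<And>i. i \<in> I \<Longrightarrow> \<sigma> i = \<tau> i) \<Longrightarrow> B s \<sigma> = B s \<tau>"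
  unfolding B_def by (intro sum.cong refl) (use h_cong[of _ \<sigma> \<tau>] in auto)

lemma B_at_cong:
  assumes "\<And>i. i \<in> insert l I \<Longrightarrow> \<sigma> i = \<tau> i"
  shows "B_at l \<sigma> = B_at l \<tau>"
proof -
  have "h l \<sigma> = h l \<tau>" if "l \<in> I" using h_cong[OF that, of \<sigma> \<tau>] assms by auto
  then show ?thesis
    unfolding B_at_def using B_cong[of \<sigma> \<tau>] assms by auto
qed

lemma Zt_cong:
  assumes "\<And>i. i \<in> {1..N + k} \<Longrightarrow> \<sigma> i = \<tau> i"
  shows "Zt t \<omega> \<sigma> = Zt t \<omega> \<tau>"
proof -
  have "A s \<sigma> = A s \<tau>" for s by (rule A_cong) (use assms in auto)
  moreover have "B s \<sigma> = B s \<tau>" for s by (rule B_cong) (use assms in auto)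
  ultimately show ?thesis by (simp add: Zt_def)
qed

lemma dens_cong:
  assumes "k \<le> m" "\<And>i. i \<in> {1..N + m} \<Longrightarrow> \<sigma> i = \<tau> i"
  shows "dens t m \<omega> \<sigma> = dens t m \<omega> \<tau>"
proof -
  have e: "exp (A (\<sigma> l) \<sigma> + t * B_at l \<sigma>) = exp (A (\<tau> l) \<tau> + t * B_at l \<tau>)" if "l \<in> J m" for l
  proof -
    have "A s \<sigma> = A s \<tau>" for s by (rule A_cong) (use assms in auto)
    moreover have "B_at l \<sigma> = B_at l \<tau>" by (rule B_at_cong) (use assms that in auto)
    ultimately show ?thesis using assms(2)[of l] that by simp
  qed
  have "V \<omega> \<sigma> = V \<omega> \<tau>" by (rule V_cong) (use assms in auto)
  moreover have "Zt t \<omega> \<sigma> = Zt t \<omega> \<tau>" by (rule Zt_cong) (use assms in auto)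
  moreover have "(\<Prod>l\<in>J m. exp (A (\<sigma> l) \<sigma> + t * B_at l \<sigma>)) = (\<Prod>l\<in>J m. exp (A (\<tau> l) \<tau> + t * B_at l \<tau>))"
    by (rule prod.cong[OF refl e])
  ultimately show ?thesis by (simp only: dens_def)
qed

lemma dens_Suc:
  assumes "k \<le> m"
  shows "dens t (Suc m) \<omega> \<sigma> = dens t m \<omega> \<sigma> * (exp (A (\<sigma> (N + m + 1)) \<sigma> + t * B (\<sigma> (N + m + 1)) \<sigma>)
           * inverse (Zt t \<omega> \<sigma>))"
proof -
  have "J (Suc m) = insert (N + m + 1) (J m)" by auto
  moreover have "B_at (N + m + 1) \<sigma> = B (\<sigma> (N + m + 1)) \<sigma>" using assms by (simp add: B_at_def)
  ultimately show ?thesis by (simp add: dens_def algebra_simps)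
qed

text \<open>An average against the tilted measure is the expectation of one more tilted replica.\<close>

lemma E_avg_tilted_replica:
  assumes t: "\<bar>t\<bar> < 2" and m: "k \<le> m"
    and \<Psi>: "bounded_measurable (overlap_algebra (J m)) \<Psi>"
    and q: "bounded_measurable (rspace \<Otimes>\<^sub>M borel) (\<lambda>(\<sigma>, s). q s \<sigma>)"
    and q_cong: "\<And>s \<sigma> \<tau>. (\<And>i. i \<in> I \<Longrightarrow> \<sigma> i = \<tau> i) \<Longrightarrow> q s \<sigma> = q s \<tau>"
  shows "E_avg M G (\<lambda>\<omega> \<sigma>. dens t m \<omega> \<sigma> * \<Psi> \<sigma> *
            ((\<integral>s. q s \<sigma> * exp (A s \<sigma> + t * B s \<sigma>) \<partial>G \<omega>) * inverse (Zt t \<omega> \<sigma>)))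
       = E_avg M G (\<lambda>\<omega> \<sigma>. dens t (Suc m) \<omega> \<sigma> * \<Psi> \<sigma> * q (\<sigma> (N + m + 1)) \<sigma>)"
proof -
  let ?u = "\<lambda>\<omega> \<sigma>. dens t m \<omega> \<sigma> * \<Psi> \<sigma> * inverse (Zt t \<omega> \<sigma>)"
  let ?w = "\<lambda>s \<sigma>. q s \<sigma> * exp (A s \<sigma> + t * B s \<sigma>)"
  have u: "bm ?u"
    by (intro bounded_measurable_mult dens_bdd t Zt_inverse_bdd bmI_overlap[OF \<Psi>]) auto
  have w: "bounded_measurable (rspace \<Otimes>\<^sub>M borel) (\<lambda>(\<sigma>, s). ?w s \<sigma>)"
    using bounded_measurable_mult[OF q weight_bdd[of t]] by (simp add: split_beta')
  have "E_avg M G (\<lambda>\<omega> \<sigma>. dens t m \<omega> \<sigma> * \<Psi> \<sigma> *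
            ((\<integral>s. q s \<sigma> * exp (A s \<sigma> + t * B s \<sigma>) \<partial>G \<omega>) * inverse (Zt t \<omega> \<sigma>)))
      = E_avg M G (\<lambda>\<omega> \<sigma>. \<integral>s. ?u \<omega> \<sigma> * ?w s \<sigma> \<partial>G \<omega>)"
  proof (rule E_avg_cong)
    fix \<omega> \<sigma>
    have "(\<integral>s. ?u \<omega> \<sigma> * ?w s \<sigma> \<partial>G \<omega>) = ?u \<omega> \<sigma> * (\<integral>s. ?w s \<sigma> \<partial>G \<omega>)"
      by (rule integral_mult_right_zero)
    then show "dens t m \<omega> \<sigma> * \<Psi> \<sigma> *
            ((\<integral>s. q s \<sigma> * exp (A s \<sigma> + t * B s \<sigma>) \<partial>G \<omega>) * inverse (Zt t \<omega> \<sigma>))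
        = (\<integral>s. ?u \<omega> \<sigma> * ?w s \<sigma> \<partial>G \<omega>)"
      by (simp only: mult_ac)
  qed
  also have "\<dots> = E_avg M G (\<lambda>\<omega> \<sigma>. ?u \<omega> \<sigma> * ?w (\<sigma> (N + m + 1)) \<sigma>)"
  proof (rule E_avg_fresh_replica)
    have "(\<lambda>z. (snd (fst z), snd z)) \<in> measurable ((M \<Otimes>\<^sub>M rspace) \<Otimes>\<^sub>M borel) (rspace \<Otimes>\<^sub>M borel)"
      by measurable
    from bounded_measurable_mult[OF bounded_measurable_compose[OF measurable_fst u]
        bounded_measurable_compose[OF this w]]
    show "bounded_measurable ((M \<Otimes>\<^sub>M rspace) \<Otimes>\<^sub>M borel)
       (\<lambda>x. ?u (fst (fst x)) (snd (fst x)) * ?w (snd x) (snd (fst x)))"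
      by simp
    fix \<omega> :: 'w and \<sigma> :: "nat \<Rightarrow> 'h" and y s
    let ?\<tau> = "\<sigma>(N + m + 1 := y)"
    have "dens t m \<omega> ?\<tau> = dens t m \<omega> \<sigma>" by (rule dens_cong[OF m]) auto
    moreover have "Zt t \<omega> ?\<tau> = Zt t \<omega> \<sigma>" by (rule Zt_cong) (use m in auto)
    moreover have "\<Psi> ?\<tau> = \<Psi> \<sigma>"
      by (rule overlap_algebra_cong[where J = "J m"]) (use \<Psi> in \<open>auto simp: bounded_measurable_def\<close>)
    moreover have "q s ?\<tau> = q s \<sigma>" by (rule q_cong) (use m in auto)
    moreover have "A s ?\<tau> = A s \<sigma>" by (rule A_cong) auto
    moreover have "B s ?\<tau> = B s \<sigma>" by (rule B_cong) (use m in auto)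
    ultimately show "?u \<omega> ?\<tau> * ?w s ?\<tau> = ?u \<omega> \<sigma> * ?w s \<sigma>" by simp
  qed simp
  also have "\<dots> = E_avg M G (\<lambda>\<omega> \<sigma>. dens t (Suc m) \<omega> \<sigma> * \<Psi> \<sigma> * q (\<sigma> (N + m + 1)) \<sigma>)"
    by (intro E_avg_cong) (simp add: dens_Suc[OF m] algebra_simps)
  finally show ?thesis .
qed

text \<open>A replica beyond the block on which the function does not depend integrates to 1.\<close>

lemma T_Suc:
  assumes t: "\<bar>t\<bar> < 2" and m: "k \<le> m" and \<Psi>: "bounded_measurable (overlap_algebra (J m)) \<Psi>"
  shows "T t (Suc m) \<Psi> = T t m \<Psi>"
proof -
  have "T t m \<Psi> = E_avg M G (\<lambda>\<omega> \<sigma>. dens t m \<omega> \<sigma> * \<Psi> \<sigma> *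
            ((\<integral>s. 1 * exp (A s \<sigma> + t * B s \<sigma>) \<partial>G \<omega>) * inverse (Zt t \<omega> \<sigma>)))"
    unfolding T_def
  proof (rule E_avg_cong)
    fix \<omega> \<sigma> assume "\<omega> \<in> space M" "\<sigma> \<in> space rspace"
    from Zt_pos[OF t this] have "(\<integral>s. 1 * exp (A s \<sigma> + t * B s \<sigma>) \<partial>G \<omega>) * inverse (Zt t \<omega> \<sigma>) = 1"
      by (simp add: Zt_def)
    then show "dens t m \<omega> \<sigma> * \<Psi> \<sigma> = dens t m \<omega> \<sigma> * \<Psi> \<sigma> *
            ((\<integral>s. 1 * exp (A s \<sigma> + t * B s \<sigma>) \<partial>G \<omega>) * inverse (Zt t \<omega> \<sigma>))"
      by (simp only: mult_1_right)
  qed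
  also have "\<dots> = E_avg M G (\<lambda>\<omega> \<sigma>. dens t (Suc m) \<omega> \<sigma> * \<Psi> \<sigma> * 1)"
    by (rule E_avg_tilted_replica[OF t m \<Psi>]) (auto simp: split_beta')
  finally show ?thesis by (simp add: T_def)
qed

text \<open>The replicas beyond the block cancel in the total mass, which is therefore bounded uniformly in
  m. This makes the Taylor remainders small enough.\<close>

lemma T_const_le:
  assumes t: "\<bar>t\<bar> < 2" and m: "k \<le> m"
  shows "T t m (\<lambda>_. 1) \<le> v * inverse z0 ^ k * inverse z0 ^ k"
  using m
proof (induction m rule: dec_induct)
  case base
  have "T t k (\<lambda>_. 1) \<le> E_avg M G (\<lambda>\<omega> \<sigma>. v * inverse z0 ^ k * inverse z0 ^ k)"
    unfolding T_def by (rule E_avg_mono) (use dens_bdd[OF t] dens_le[OF t] in auto)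
  then show ?case by (simp add: E_avg_const)
next
  case (step m)
  then show ?case using T_Suc[OF t, of m "\<lambda>_. 1"] by simp
qed

lemma abs_T_le:
  assumes t: "\<bar>t\<bar> < 2" and m: "k \<le> m" and \<Psi>: "bounded_measurable (overlap_algebra (J m)) \<Psi>"
    and b: "\<And>\<sigma>. \<bar>\<Psi> \<sigma>\<bar> \<le> b"
  shows "\<bar>T t m \<Psi>\<bar> \<le> b * (v * inverse z0 ^ k * inverse z0 ^ k)"
proof -
  have \<Psi>1: "bm (\<lambda>\<omega>. \<Psi>)" by (rule bmI_overlap[OF \<Psi>]) auto
  have b0: "0 \<le> b" using b[of undefined] by linarith
  have le: "\<bar>dens t m \<omega> \<sigma> * \<Psi> \<sigma>\<bar> \<le> b * (dens t m \<omega> \<sigma> * 1)" if "\<omega> \<in> space M" "\<sigma> \<in> space rspace" for \<omega> \<sigma>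
    using mult_left_mono[OF b dens_nonneg[OF t that]] dens_nonneg[OF t that, of m]
    by (simp add: abs_mult mult.commute)
  have bm1: "bm (\<lambda>\<omega> \<sigma>. dens t m \<omega> \<sigma> * \<Psi> \<sigma>)" by (intro bounded_measurable_mult dens_bdd t \<Psi>1)
  have bm2: "bm (\<lambda>\<omega> \<sigma>. b' * (dens t m \<omega> \<sigma> * 1))" for b'
    by (intro bounded_measurable_mult dens_bdd t bounded_measurable_const)
  have "T t m \<Psi> \<le> E_avg M G (\<lambda>\<omega> \<sigma>. b * (dens t m \<omega> \<sigma> * 1))"
    unfolding T_def by (rule E_avg_mono[OF bm1 bm2]) (use le in \<open>simp add: abs_le_iff\<close>)
  moreover have "E_avg M G (\<lambda>\<omega> \<sigma>. (- b) * (dens t m \<omega> \<sigma> * 1)) \<le> T t m \<Psi>"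
    unfolding T_def by (rule E_avg_mono[OF bm2 bm1]) (use le in \<open>fastforce simp: abs_le_iff\<close>)
  ultimately have "\<bar>T t m \<Psi>\<bar> \<le> b * T t m (\<lambda>_. 1)"
    unfolding E_avg_cmult by (simp add: T_def abs_le_iff)
  also have "\<dots> \<le> b * (v * inverse z0 ^ k * inverse z0 ^ k)"
    by (rule mult_left_mono[OF T_const_le[OF t m] b0])
  finally show ?thesis .
qed

lemma dens_has_real_derivative:
  assumes t: "\<bar>t\<bar> < 2" and \<omega>: "\<omega> \<in> space M" and \<sigma>: "\<sigma> \<in> space rspace"
  shows "((\<lambda>t. dens t m \<omega> \<sigma>) has_real_derivative
     dens t m \<omega> \<sigma> * ((\<Sum>l\<in>J m. B_at l \<sigma>) - real m * (Zt_deriv t \<omega> \<sigma> * inverse (Zt t \<omega> \<sigma>)))) (at t)"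
proof -
  have p: "((\<lambda>t. \<Prod>l\<in>J m. exp (A (\<sigma> l) \<sigma> + t * B_at l \<sigma>)) has_real_derivative
      (\<Prod>l\<in>J m. exp (A (\<sigma> l) \<sigma> + t * B_at l \<sigma>)) * (\<Sum>l\<in>J m. B_at l \<sigma>)) (at t)"
    unfolding exp_sum[symmetric, OF finite_atLeastAtMost] sum.distrib sum_distrib_left[symmetric]
    by (auto intro!: derivative_eq_intros)
  have z: "((\<lambda>t. inverse (Zt t \<omega> \<sigma>) ^ m) has_real_derivative
      - (real m * (Zt_deriv t \<omega> \<sigma> * inverse (Zt t \<omega> \<sigma>))) * inverse (Zt t \<omega> \<sigma>) ^ m) (at t)"
  proof -
    have "((\<lambda>t. inverse (Zt t \<omega> \<sigma>)) has_real_derivative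
        - (inverse (Zt t \<omega> \<sigma>) * Zt_deriv t \<omega> \<sigma> * inverse (Zt t \<omega> \<sigma>))) (at t)"
      by (rule DERIV_inverse'[OF Zt_has_real_derivative[OF t \<omega> \<sigma>]]) (use Zt_pos[OF t \<omega> \<sigma>] in simp)
    from DERIV_power[OF this, of m] show ?thesis
      by (cases m) (simp_all add: algebra_simps)
  qed
  show ?thesis
    unfolding dens_def
    by (rule derivative_eq_intros p z refl | simp add: algebra_simps)+
qed

text \<open>Differentiation in t produces one more replica and the factor D.\<close>

lemma T_has_real_derivative:
  assumes t: "\<bar>t\<bar> < 2" and m: "k \<le> m" and \<Psi>: "bounded_measurable (overlap_algebra (J m)) \<Psi>"
  shows "((\<lambda>t. T t m \<Psi>) has_real_derivative T t (Suc m) (\<lambda>\<sigma>. \<Psi> \<sigma> * D m \<sigma>)) (at t)"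
proof -
  have \<Psi>1: "bm (\<lambda>\<omega>. \<Psi>)" by (rule bmI_overlap[OF \<Psi>]) auto
  obtain b where b0: "0 \<le> b" and b: "\<And>\<sigma>. \<bar>\<Psi> \<sigma>\<bar> \<le> b"
    using bounded_measurableE[OF \<Psi>] by (metis UNIV_I space_overlap_algebra)
  let ?S = "\<lambda>\<sigma>. \<Sum>l\<in>J m. B_at l \<sigma>"
  let ?g' = "\<lambda>t \<omega> \<sigma>. dens t m \<omega> \<sigma> * (?S \<sigma> - real m * (Zt_deriv t \<omega> \<sigma> * inverse (Zt t \<omega> \<sigma>))) * \<Psi> \<sigma>"
  have S: "bounded_measurable (overlap_algebra (J m)) ?S"
    by (intro bounded_measurable_sum B_at_bdd) (use m in auto)
  have S1: "bm (\<lambda>\<omega>. ?S)" by (rule bmI_overlap[OF S]) auto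
  have g'_bm: "bm (?g' t)"
    by (intro bounded_measurable_mult bounded_measurable_diff bounded_measurable_const
        dens_bdd t S1 Zt_deriv_bdd Zt_inverse_bdd \<Psi>1)
  have "((\<lambda>t. T t m \<Psi>) has_real_derivative E_avg M G (?g' t)) (at t)"
    unfolding T_def
  proof (rule E_avg_has_real_derivative[where a = "-2" and b = 2
        and K = "v * inverse z0 ^ m * inverse z0 ^ m * (2 * L * real m) * b"])
    fix t :: real and \<omega> \<sigma>
    assume tt: "t \<in> {-2<..<2}" and \<omega>: "\<omega> \<in> space M" and \<sigma>: "\<sigma> \<in> space rspace"
    from tt have t2: "\<bar>t\<bar> < 2" by auto
    show "((\<lambda>t. dens t m \<omega> \<sigma> * \<Psi> \<sigma>) has_real_derivative ?g' t \<omega> \<sigma>) (at t)"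
      by (rule DERIV_cmult_right[OF dens_has_real_derivative[OF t2 \<omega> \<sigma>]])
    have "\<bar>?S \<sigma>\<bar> \<le> (\<Sum>l\<in>J m. L)"
      by (rule order_trans[OF sum_abs sum_mono]) (rule abs_B_at_le)
    moreover have "\<bar>Zt_deriv t \<omega> \<sigma> * inverse (Zt t \<omega> \<sigma>)\<bar> \<le> L"
      using Zt_pos[OF t2 \<omega> \<sigma>] Zt_deriv_le[OF t2 \<omega> \<sigma>]
      by (simp add: abs_mult divide_inverse[symmetric] divide_le_eq)
    then have "\<bar>real m * (Zt_deriv t \<omega> \<sigma> * inverse (Zt t \<omega> \<sigma>))\<bar> \<le> real m * L"
      unfolding abs_mult[of "real m"] by (simp add: mult_left_mono)
    ultimately have "\<bar>?S \<sigma> - real m * (Zt_deriv t \<omega> \<sigma> * inverse (Zt t \<omega> \<sigma>))\<bar> \<le> 2 * L * real m"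
      by (simp add: algebra_simps)
    moreover have "0 \<le> v" using V_nonneg[OF \<omega> \<sigma>] V_le[OF \<omega> \<sigma>] by (rule order_trans)
    ultimately show "\<bar>?g' t \<omega> \<sigma>\<bar> \<le> v * inverse z0 ^ m * inverse z0 ^ m * (2 * L * real m) * b"
      unfolding abs_mult[of _ "\<Psi> \<sigma>"] abs_mult[of "dens t m \<omega> \<sigma>"]
      using dens_le[OF t2 \<omega> \<sigma>, of m] dens_nonneg[OF t2 \<omega> \<sigma>, of m] b b0 L_pos z0_pos
      by (intro mult_mono mult_nonneg_nonneg) auto
  next
    show "bm (\<lambda>\<omega> \<sigma>. dens t m \<omega> \<sigma> * \<Psi> \<sigma>)" if "t \<in> {-2<..<2}" for t
      by (intro bounded_measurable_mult dens_bdd \<Psi>1) (use that in auto)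
  qed (use g'_bm t in auto)
  moreover have "E_avg M G (?g' t) = T t (Suc m) (\<lambda>\<sigma>. \<Psi> \<sigma> * D m \<sigma>)"
  proof -
    have 1: "bm (\<lambda>\<omega> \<sigma>. dens t m \<omega> \<sigma> * (\<Psi> \<sigma> * ?S \<sigma>))"
      by (intro bounded_measurable_mult dens_bdd t S1 \<Psi>1)
    have 2: "bm (\<lambda>\<omega> \<sigma>. real m * (dens t m \<omega> \<sigma> * \<Psi> \<sigma> * (Zt_deriv t \<omega> \<sigma> * inverse (Zt t \<omega> \<sigma>))))"
      by (intro bounded_measurable_mult bounded_measurable_const dens_bdd t \<Psi>1 Zt_deriv_bdd Zt_inverse_bdd)
    have 3: "bm (\<lambda>\<omega> \<sigma>. dens t (Suc m) \<omega> \<sigma> * (\<Psi> \<sigma> * ?S \<sigma>))"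
      by (intro bounded_measurable_mult dens_bdd t S1 \<Psi>1)
    have 4: "bm (\<lambda>\<omega> \<sigma>. real m * (dens t (Suc m) \<omega> \<sigma> * \<Psi> \<sigma> * B (\<sigma> (N + m + 1)) \<sigma>))"
      by (intro bounded_measurable_mult bounded_measurable_const dens_bdd t \<Psi>1 bm_at_replica[OF B_pair_bdd]) auto
    have "E_avg M G (?g' t) = E_avg M G (\<lambda>\<omega> \<sigma>. dens t m \<omega> \<sigma> * (\<Psi> \<sigma> * ?S \<sigma>)
        - real m * (dens t m \<omega> \<sigma> * \<Psi> \<sigma> * (Zt_deriv t \<omega> \<sigma> * inverse (Zt t \<omega> \<sigma>))))"
      by (intro E_avg_cong) (simp add: algebra_simps)
    also have "\<dots> = T t m (\<lambda>\<sigma>. \<Psi> \<sigma> * ?S \<sigma>)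
        - real m * E_avg M G (\<lambda>\<omega> \<sigma>. dens t m \<omega> \<sigma> * \<Psi> \<sigma> * (Zt_deriv t \<omega> \<sigma> * inverse (Zt t \<omega> \<sigma>)))"
      unfolding E_avg_diff[OF 1 2] E_avg_cmult T_def ..
    also have "T t m (\<lambda>\<sigma>. \<Psi> \<sigma> * ?S \<sigma>) = T t (Suc m) (\<lambda>\<sigma>. \<Psi> \<sigma> * ?S \<sigma>)"
      by (rule T_Suc[OF t m bounded_measurable_mult[OF \<Psi> S], symmetric])
    also have "E_avg M G (\<lambda>\<omega> \<sigma>. dens t m \<omega> \<sigma> * \<Psi> \<sigma> * (Zt_deriv t \<omega> \<sigma> * inverse (Zt t \<omega> \<sigma>)))
        = E_avg M G (\<lambda>\<omega> \<sigma>. dens t (Suc m) \<omega> \<sigma> * \<Psi> \<sigma> * B (\<sigma> (N + m + 1)) \<sigma>)"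
      unfolding Zt_deriv_def by (rule E_avg_tilted_replica[OF t m \<Psi> B_pair_bdd B_cong])
    also have "T t (Suc m) (\<lambda>\<sigma>. \<Psi> \<sigma> * ?S \<sigma>)
        - real m * E_avg M G (\<lambda>\<omega> \<sigma>. dens t (Suc m) \<omega> \<sigma> * \<Psi> \<sigma> * B (\<sigma> (N + m + 1)) \<sigma>)
        = E_avg M G (\<lambda>\<omega> \<sigma>. dens t (Suc m) \<omega> \<sigma> * (\<Psi> \<sigma> * ?S \<sigma>)
            - real m * (dens t (Suc m) \<omega> \<sigma> * \<Psi> \<sigma> * B (\<sigma> (N + m + 1)) \<sigma>))"
      unfolding E_avg_diff[OF 3 4] E_avg_cmult T_def ..
    also have "\<dots> = T t (Suc m) (\<lambda>\<sigma>. \<Psi> \<sigma> * D m \<sigma>)"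
      unfolding T_def by (intro E_avg_cong) (simp add: D_def algebra_simps)
    finally show ?thesis .
  qed
  ultimately show ?thesis by simp
qed

subsection \<open>The Taylor argument\<close>

text \<open>The product is the bound for the factors D that j derivatives produce.\<close>

lemma rising_product_le: "(\<Prod>i<j. real (Suc p + i)) \<le> 2 ^ (p + j) * fact j"
proof -
  have "(\<Prod>i<j. real (Suc p + i)) * fact p = fact (p + j)"
  proof (induction j)
    case (Suc j)
    have "(\<Prod>i<Suc j. real (Suc p + i)) * fact p = (\<Prod>i<j. real (Suc p + i)) * fact p * real (Suc p + j)"
      by (simp only: prod.lessThan_Suc mult_ac)
    also have "\<dots> = fact (p + Suc j)"
      unfolding Suc.IH by (simp add: algebra_simps)
    finally show ?case .
  qed simp
  moreover have "fact j * fact p * real (p + j choose j) = fact (p + j)"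
  proof -
    have "real (fact j * fact p * (p + j choose j)) = real (fact (p + j))"
      using binomial_fact_lemma[of j "p + j"] by simp
    then show ?thesis by (simp only: of_nat_mult of_nat_fact)
  qed
  ultimately have "(\<Prod>i<j. real (Suc p + i)) * fact p = (fact j * real (p + j choose j)) * fact p"
    by (simp only: mult_ac)
  then have "(\<Prod>i<j. real (Suc p + i)) = fact j * real (p + j choose j)"
    by (rule mult_right_cancel[THEN iffD1, OF fact_nonzero])
  also have "\<dots> \<le> fact j * 2 ^ (p + j)"
    using binomial_le_pow2[of "p + j" j] by (intro mult_left_mono) (simp_all flip: of_nat_le_iff)
  finally show ?thesis by (simp add: mult.commute)
qed

lemma T_0:
  assumes "bounded_measurable (overlap_algebra (J m)) \<Psi>"
  shows "T 0 m \<Psi> = E_avg M G (\<lambda>\<omega> \<sigma>. \<Psi> \<sigma>)"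
  using tilt_invariance[OF assms] by (simp add: T_def dens_def Zt_def)

text \<open>If T does not change the law of the overlaps at t0, all of its derivatives vanish there. Since
  the radius of convergence of its Taylor series does not depend on the function averaged, the same
  holds on an interval of fixed length after t0.\<close>

lemma T_invariance_step:
  assumes inv: "\<And>m \<Psi>. max 2 k \<le> m \<Longrightarrow> bounded_measurable (overlap_algebra (J m)) \<Psi> \<Longrightarrow>
                  T t0 m \<Psi> = E_avg M G (\<lambda>\<omega> \<sigma>. \<Psi> \<sigma>)"
    and t: "0 \<le> t0" "t0 \<le> t" "t < 2" "8 * L * (t - t0) \<le> 1"
    and m: "max 2 k \<le> m" and \<Psi>: "bounded_measurable (overlap_algebra (J m)) \<Psi>"
  shows "T t m \<Psi> = E_avg M G (\<lambda>\<omega> \<sigma>. \<Psi> \<sigma>)"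
proof (cases "t0 = t")
  case True
  then show ?thesis using inv[OF m \<Psi>] by simp
next
  case False
  obtain b where b0: "0 \<le> b" and b: "\<And>\<sigma>. \<bar>\<Psi> \<sigma>\<bar> \<le> b"
    using bounded_measurableE[OF \<Psi>] by (metis UNIV_I space_overlap_algebra)
  obtain p where p: "m = Suc p" using m by (cases m) auto
  let ?C = "v * inverse z0 ^ k * inverse z0 ^ k"
  \<comment> \<open>The j-th derivative of the tilted average of \<Psi> is the tilted average of \<Phi> j.\<close>
  define \<Phi> where "\<Phi> j \<sigma> = \<Psi> \<sigma> * (\<Prod>i<j. D (m + i) \<sigma>)" for j \<sigma>
  have \<Phi>_bdd: "bounded_measurable (overlap_algebra (J (m + j))) (\<Phi> j)" for j
    unfolding \<Phi>_def
  proof (intro bounded_measurable_mult bounded_measurable_prod)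
    show "bounded_measurable (overlap_algebra (J (m + j))) \<Psi>"
      by (rule bounded_measurable_compose[OF overlap_algebra_mono \<Psi>]) auto
    show "bounded_measurable (overlap_algebra (J (m + j))) (D (m + i))" if "i \<in> {..<j}" for i
      by (rule bounded_measurable_compose[OF overlap_algebra_mono D_bdd]) (use m that in auto)
  qed
  have \<Phi>_le: "\<bar>\<Phi> j \<sigma>\<bar> \<le> b * ((2 * L) ^ j * (2 ^ (p + j) * fact j))" for j \<sigma>
  proof -
    have "\<bar>\<Prod>i<j. D (m + i) \<sigma>\<bar> \<le> (\<Prod>i<j. 2 * L * real (m + i))"
      unfolding abs_prod by (intro prod_mono conjI abs_ge_zero abs_D_le)
    also have "\<dots> = (2 * L) ^ j * (\<Prod>i<j. real (Suc p + i))"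
      by (simp add: prod.distrib p)
    also have "\<dots> \<le> (2 * L) ^ j * (2 ^ (p + j) * fact j)"
      by (rule mult_left_mono[OF rising_product_le]) (use L_pos in simp)
    finally show ?thesis
      unfolding \<Phi>_def abs_mult using b b0 by (intro mult_mono) auto
  qed
  have deriv: "((\<lambda>t. T t (m + j) (\<Phi> j)) has_real_derivative T s (m + Suc j) (\<Phi> (Suc j))) (at s)"
    if "\<bar>s\<bar> < 2" for j s
    using T_has_real_derivative[OF that _ \<Phi>_bdd[of j]] m by (simp add: \<Phi>_def[abs_def] mult.assoc)
  \<comment> \<open>The last factor D of \<Phi> is the only one that involves the last replica, and it averages out.\<close>
  have vanish: "T t0 (m + Suc j) (\<Phi> (Suc j)) = 0" for j
  proof -
    have "T t0 (m + Suc j) (\<Phi> (Suc j)) = E_avg M G (\<lambda>\<omega> \<sigma>. \<Phi> (Suc j) \<sigma>)"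
      by (rule inv[OF _ \<Phi>_bdd]) (use m in auto)
    also have "\<dots> = E_avg M G (\<lambda>\<omega> \<sigma>. \<Phi> j \<sigma> * D (m + j) \<sigma>)"
      by (simp add: \<Phi>_def mult.assoc)
    also have "\<dots> = 0" by (rule E_avg_D_eq_0[OF _ _ \<Phi>_bdd]) (use m in auto)
    finally show ?thesis .
  qed
  have close: "\<bar>T t m \<Psi> - T t0 m \<Psi>\<bar> \<le> b * ?C * 2 ^ p * (1 / 2) ^ j" if j: "0 < j" for j
  proof -
    have "\<exists>s. t0 < s \<and> s < t \<and> T t m \<Psi> = (\<Sum>i<j. T t0 (m + i) (\<Phi> i) / fact i * (t - t0) ^ i)
            + T s (m + j) (\<Phi> j) / fact j * (t - t0) ^ j"
      by (rule Taylor_up[where a = t0 and b = t and diff = "\<lambda>i t. T t (m + i) (\<Phi> i)"])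
         (use t False j deriv in \<open>auto simp: \<Phi>_def[abs_def]\<close>)
    then obtain s where s: "t0 < s" "s < t" and
      eq: "T t m \<Psi> = (\<Sum>i<j. T t0 (m + i) (\<Phi> i) / fact i * (t - t0) ^ i)
            + T s (m + j) (\<Phi> j) / fact j * (t - t0) ^ j"
      by blast
    have "(\<Sum>i<j. T t0 (m + i) (\<Phi> i) / fact i * (t - t0) ^ i)
        = (\<Sum>i<j. if i = 0 then T t0 m \<Psi> else 0)"
    proof (rule sum.cong[OF refl])
      fix i show "T t0 (m + i) (\<Phi> i) / fact i * (t - t0) ^ i = (if i = 0 then T t0 m \<Psi> else 0)"
        using vanish by (cases i) (simp_all add: \<Phi>_def[abs_def])
    qed
    also have "\<dots> = T t0 m \<Psi>" using j by simp
    finally have "\<bar>T t m \<Psi> - T t0 m \<Psi>\<bar> = \<bar>T s (m + j) (\<Phi> j)\<bar> / fact j * (t - t0) ^ j"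
      unfolding eq using t by (simp add: abs_mult)
    also have "\<dots> \<le> b * ((2 * L) ^ j * (2 ^ (p + j) * fact j)) * ?C / fact j * (t - t0) ^ j"
      by (intro mult_right_mono divide_right_mono abs_T_le[OF _ _ \<Phi>_bdd \<Phi>_le]) (use s t m in auto)
    also have "\<dots> = b * ?C * 2 ^ p * (4 * L * (t - t0)) ^ j"
    proof -
      have "(4::real) ^ j = 2 ^ j * 2 ^ j" by (simp flip: power_mult_distrib)
      then show ?thesis by (simp add: power_mult_distrib power_add)
    qed
    also have "\<dots> \<le> b * ?C * 2 ^ p * (1 / 2) ^ j"
    proof (intro mult_left_mono power_mono)
      have "0 \<le> T 0 k (\<lambda>_. 1)" using T_0[of k "\<lambda>_. 1"] by (simp add: E_avg_const)
      then have "0 \<le> ?C" using T_const_le[of 0 k] by simp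
      then show "0 \<le> b * ?C * 2 ^ p" using b0 by simp
    qed (use t L_pos in auto)
    finally show ?thesis .
  qed
  have "(\<lambda>j. b * ?C * 2 ^ p * (1 / 2) ^ j) \<longlonglongrightarrow> b * ?C * 2 ^ p * 0"
    by (intro tendsto_mult tendsto_const LIMSEQ_power_zero) simp
  then have "\<bar>T t m \<Psi> - T t0 m \<Psi>\<bar> \<le> 0"
    by (intro LIMSEQ_le_const[where X = "\<lambda>j. b * ?C * 2 ^ p * (1 / 2) ^ j"])
       (auto intro!: exI[of _ 1] close)
  then show ?thesis using inv[OF m \<Psi>] by simp
qed

lemma T_1:
  assumes m: "k \<le> m" and \<Psi>: "bounded_measurable (overlap_algebra (J m)) \<Psi>"
  shows "T 1 m \<Psi> = E_avg M G (\<lambda>\<omega> \<sigma>. \<Psi> \<sigma>)"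
proof -
  \<comment> \<open>The interval from 0 to 1 is covered by d steps of length 1 / d.\<close>
  obtain d :: nat where d: "8 * L \<le> real d" using real_arch_simple by blast
  with L_pos have d0: "0 < real d" by linarith
  have "\<forall>m \<Psi>. max 2 k \<le> m \<longrightarrow> bounded_measurable (overlap_algebra (J m)) \<Psi> \<longrightarrow>
          T (real i / real d) m \<Psi> = E_avg M G (\<lambda>\<omega> \<sigma>. \<Psi> \<sigma>)" if "i \<le> d" for i
    using that
  proof (induction i)
    case 0
    then show ?case using T_0 by simp
  next
    case (Suc i)
    have "real (Suc i) / real d \<le> 1" using Suc.prems d0 by simp
    moreover have "real (Suc i) / real d - real i / real d = 1 / real d"
      by (simp add: diff_divide_distrib[symmetric])
    moreover have "8 * L * (1 / real d) \<le> 1" using d d0 by simp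
    ultimately have t: "0 \<le> real i / real d" "real i / real d \<le> real (Suc i) / real d"
      "real (Suc i) / real d < 2" "8 * L * (real (Suc i) / real d - real i / real d) \<le> 1"
      by (simp_all add: divide_right_mono)
    have "T (real i / real d) m \<Psi> = E_avg M G (\<lambda>\<omega> \<sigma>. \<Psi> \<sigma>)"
      if "max 2 k \<le> m" "bounded_measurable (overlap_algebra (J m)) \<Psi>" for m \<Psi>
      using Suc that by simp
    from T_invariance_step[OF this t] show ?case by (intro allI impI)
  qed
  from this[of d] d0 have one: "T 1 m \<Psi> = E_avg M G (\<lambda>\<omega> \<sigma>. \<Psi> \<sigma>)"
    if "max 2 k \<le> m" "bounded_measurable (overlap_algebra (J m)) \<Psi>" for m \<Psi>
    using that by simp
  \<comment> \<open>Two redundant replicas are added because the identities require at least two.\<close>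
  have \<Psi>': "bounded_measurable (overlap_algebra (J (m + i))) \<Psi>" for i
    by (rule bounded_measurable_compose[OF overlap_algebra_mono \<Psi>]) auto
  have "T 1 m \<Psi> = T 1 (Suc m) \<Psi>"
    using T_Suc[OF _ m \<Psi>, of 1] by simp
  also have "\<dots> = T 1 (Suc (Suc m)) \<Psi>"
    using T_Suc[of 1 "Suc m" \<Psi>] \<Psi>'[of 1] m by (simp only: Suc_eq_plus1)
  also have "\<dots> = T 1 (m + 2) \<Psi>" by (simp only: add_2_eq_Suc')
  also have "\<dots> = E_avg M G (\<lambda>\<omega> \<sigma>. \<Psi> \<sigma>)" by (rule one[OF _ \<Psi>']) (use m in auto)
  finally show ?thesis .
qed

text \<open>After the block has been processed, its replicas are used up and its potential joins A.\<close>

theorem tilted_system_after_block: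
  "tilted_system M G (N + k) (dens 1 k) (\<lambda>s \<sigma>. A s \<sigma> + B s \<sigma>)
     (v * inverse z0 ^ k * inverse z0 ^ k) (a + L)"
proof unfold_locales
  show "(\<lambda>x. dens 1 k (fst x) (snd x)) \<in> borel_measurable (M \<Otimes>\<^sub>M rspace)"
    using dens_bdd[of 1 k] by (simp add: bounded_measurable_def)
  show "0 \<le> dens 1 k \<omega> \<sigma>" "dens 1 k \<omega> \<sigma> \<le> v * inverse z0 ^ k * inverse z0 ^ k"
    if "\<omega> \<in> space M" "\<sigma> \<in> space rspace" for \<omega> \<sigma>
    using dens_nonneg[of 1 \<omega> \<sigma> k] dens_le[of 1 \<omega> \<sigma> k] that by simp_all
  show "dens 1 k \<omega> \<sigma> = dens 1 k \<omega> \<tau>" if "\<And>l. l \<in> {1..N + k} \<Longrightarrow> \<sigma> l = \<tau> l" for \<omega> \<sigma> \<tau>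
    by (rule dens_cong) (use that in auto)
  show "(\<lambda>(\<sigma>, s). A s \<sigma> + B s \<sigma>) \<in> borel_measurable (rspace \<Otimes>\<^sub>M borel)"
    using bounded_measurable_add[OF A_bdd B_pair_bdd] by (simp add: bounded_measurable_def split_beta')
  show "\<bar>A s \<sigma> + B s \<sigma>\<bar> \<le> a + L" for s \<sigma>
    using A_le[of s \<sigma>] abs_B_le_L[of s \<sigma>] by linarith
  show "A s \<sigma> + B s \<sigma> = A s \<tau> + B s \<tau>" if "\<And>l. l \<in> {1..N + k} \<Longrightarrow> \<sigma> l = \<tau> l" for s \<sigma> \<tau>
    using A_cong[of \<sigma> \<tau> s] B_cong[of \<sigma> \<tau> s] that by auto
  fix m and \<Psi> :: "(nat \<Rightarrow> 'h) \<Rightarrow> real"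
  assume \<Psi>: "bounded_measurable (overlap_algebra {N + k + 1..N + k + m}) \<Psi>"
  have \<Psi>': "bounded_measurable (overlap_algebra (J (k + m))) \<Psi>"
    by (rule bounded_measurable_compose[OF overlap_algebra_mono \<Psi>]) auto
  have "dens 1 k \<omega> \<sigma> * (\<Prod>l\<in>{N + k + 1..N + k + m}. exp (A (\<sigma> l) \<sigma> + B (\<sigma> l) \<sigma>))
      * inverse (\<integral>s. exp (A s \<sigma> + B s \<sigma>) \<partial>G \<omega>) ^ m = dens 1 (k + m) \<omega> \<sigma>" for \<omega> \<sigma>
  proof -
    have U: "J (k + m) = J k \<union> {N + k + 1..N + k + m}" and disj: "J k \<inter> {N + k + 1..N + k + m} = {}"
      by auto
    have "(\<Prod>l\<in>J (k + m). exp (A (\<sigma> l) \<sigma> + 1 * B_at l \<sigma>))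
        = (\<Prod>l\<in>J k. exp (A (\<sigma> l) \<sigma> + 1 * B_at l \<sigma>))
          * (\<Prod>l\<in>{N + k + 1..N + k + m}. exp (A (\<sigma> l) \<sigma> + 1 * B_at l \<sigma>))"
      unfolding U by (rule prod.union_disjoint[OF finite_atLeastAtMost finite_atLeastAtMost disj])
    also have "(\<Prod>l\<in>{N + k + 1..N + k + m}. exp (A (\<sigma> l) \<sigma> + 1 * B_at l \<sigma>))
        = (\<Prod>l\<in>{N + k + 1..N + k + m}. exp (A (\<sigma> l) \<sigma> + B (\<sigma> l) \<sigma>))"
    proof (rule prod.cong[OF refl])
      fix l assume "l \<in> {N + k + 1..N + k + m}"
      then have "l \<notin> I" by simp
      then show "exp (A (\<sigma> l) \<sigma> + 1 * B_at l \<sigma>) = exp (A (\<sigma> l) \<sigma> + B (\<sigma> l) \<sigma>)"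
        unfolding B_at_def by (simp only: if_False add_0_right mult_1_left)
    qed
    finally have P: "(\<Prod>l\<in>J (k + m). exp (A (\<sigma> l) \<sigma> + 1 * B_at l \<sigma>))
        = (\<Prod>l\<in>J k. exp (A (\<sigma> l) \<sigma> + 1 * B_at l \<sigma>))
          * (\<Prod>l\<in>{N + k + 1..N + k + m}. exp (A (\<sigma> l) \<sigma> + B (\<sigma> l) \<sigma>))" .
    show ?thesis
      unfolding dens_def Zt_def power_add mult_1_left P[unfolded mult_1_left] by (simp only: mult_ac)
  qed
  note D1 = this
  show "E_avg M G (\<lambda>\<omega> \<sigma>. dens 1 k \<omega> \<sigma> * (\<Prod>l\<in>{N + k + 1..N + k + m}. exp (A (\<sigma> l) \<sigma> + B (\<sigma> l) \<sigma>))
              * inverse (\<integral>s. exp (A s \<sigma> + B s \<sigma>) \<partial>G \<omega>) ^ m * \<Psi> \<sigma>)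
          = E_avg M G (\<lambda>\<omega> \<sigma>. \<Psi> \<sigma>)"
    unfolding D1 T_1[OF _ \<Psi>', symmetric, OF le_add1] T_def ..
qed

end

section \<open>Iteration over the blocks\<close>

lemma pairs_subset: "pairs I \<subseteq> I \<times> I"
  by (auto simp: pairs_def)

lemma block_overlaps_measurable:
  "block_overlaps n p \<in> measurable (overlap_algebra (block n p) :: (nat \<Rightarrow> 'h::real_inner) measure) (block_space n p)"
  unfolding block_overlaps_def[abs_def] by (rule measurable_overlaps_overlap_algebra[OF pairs_subset])

lemma block_function_bdd:
  assumes "bounded_measurable (block_space n p \<Otimes>\<^sub>M borel) (\<lambda>(R, x). g R x)"
  shows "bounded_measurable (overlap_algebra (block n p) \<Otimes>\<^sub>M borel :: ((nat \<Rightarrow> 'h::real_inner) \<times> real) measure)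
           (\<lambda>(\<sigma>, x). g (block_overlaps n p \<sigma>) x)"
proof -
  have "(\<lambda>z. (block_overlaps n p (fst z), snd z)) \<in> measurable
      (overlap_algebra (block n p) \<Otimes>\<^sub>M borel :: ((nat \<Rightarrow> 'h) \<times> real) measure) (block_space n p \<Otimes>\<^sub>M borel)"
    by (rule measurable_Pair[OF measurable_compose[OF measurable_fst block_overlaps_measurable] measurable_snd])
  from bounded_measurable_compose[OF this assms] show ?thesis by (simp add: split_beta')
qed

context ghirlanda_guerra_measure
begin

lemma tilted_system_initial: "tilted_system M G 0 (\<lambda>_ _. 1) (\<lambda>_ _. 0) 1 0"
proof unfold_locales
  fix m and \<Psi> :: "(nat \<Rightarrow> 'h) \<Rightarrow> real"
  show "E_avg M G (\<lambda>\<omega> \<sigma>. 1 * (\<Prod>l\<in>{0 + 1..0 + m}. exp 0) * inverse (\<integral>s. exp 0 \<partial>G \<omega>) ^ m * \<Psi> \<sigma>)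
      = E_avg M G (\<lambda>\<omega> \<sigma>. \<Psi> \<sigma>)"
    by (intro E_avg_cong) (simp add: prob_space.prob_space[OF prob_G])
qed auto

text \<open>The density that the next block contributes is the factor Z: the exponents F_at are the potentials
  with replaced self-interactions, because the earlier blocks contribute their full potential.\<close>

lemma tilted_system_block:
  fixes n :: "nat \<Rightarrow> nat" and f :: "nat \<Rightarrow> (nat \<times> nat \<Rightarrow> real) \<Rightarrow> real \<Rightarrow> real"
  assumes sys: "tilted_system M G (n p) (\<lambda>\<omega> \<sigma>. \<Prod>q = 1..p. Z M G n f q \<omega> \<sigma>) (F n f p) v a"
    and le: "n p \<le> n (Suc p)"
    and f: "\<And>l. l \<in> block n (Suc p) \<Longrightarrow>
              bounded_measurable (block_space n (Suc p) \<Otimes>\<^sub>M borel) (\<lambda>(R, x). f l R x)"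
  shows "\<exists>v a. tilted_system M G (n (Suc p)) (\<lambda>\<omega> \<sigma>. \<Prod>q = 1..Suc p. Z M G n f q \<omega> \<sigma>) (F n f (Suc p)) v a"
    and "bounded_measurable (overlap_algebra (block n (Suc p))) \<Psi> \<Longrightarrow>
           E_avg M G (\<lambda>\<omega> \<sigma>. (\<Prod>q = 1..Suc p. Z M G n f q \<omega> \<sigma>) * \<Psi> \<sigma>) = E_avg M G (\<lambda>\<omega> \<sigma>. \<Psi> \<sigma>)"
proof -
  define k where "k = n (Suc p) - n p"
  have N: "n p + k = n (Suc p)" using le by (simp add: k_def)
  have blk: "{n p + 1..n p + k} = block n (Suc p)" by (simp add: block_def N)
  define h :: "nat \<Rightarrow> (nat \<Rightarrow> 'h) \<Rightarrow> real \<Rightarrow> real"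
    where "h l \<sigma> x = f l (block_overlaps n (Suc p) \<sigma>) x" for l \<sigma> x
  have h: "bounded_measurable (overlap_algebra (block n (Suc p)) \<Otimes>\<^sub>M borel) (\<lambda>(\<sigma>, x). h l \<sigma> x)"
    if "l \<in> block n (Suc p)" for l
    unfolding h_def by (rule block_function_bdd[OF f[OF that]])
  have "\<exists>c. \<forall>\<sigma> x. \<bar>h l \<sigma> x\<bar> \<le> c" if l: "l \<in> block n (Suc p)" for l
  proof -
    obtain c where c: "\<And>z. z \<in> space (overlap_algebra (block n (Suc p)) \<Otimes>\<^sub>M borel) \<Longrightarrow> \<bar>case z of (\<sigma>, x) \<Rightarrow> h l \<sigma> x\<bar> \<le> c"
      using bounded_measurableE[OF h[OF l]] by metis
    have "\<bar>h l \<sigma> x\<bar> \<le> c" for \<sigma> x using c[of "(\<sigma>, x)"] by (simp add: space_pair_measure)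
    then show ?thesis by blast
  qed
  then obtain C where "\<forall>l\<in>block n (Suc p). \<forall>\<sigma> x. \<bar>h l \<sigma> x\<bar> \<le> C l"
    using bchoice[of "block n (Suc p)" "\<lambda>l c. \<forall>\<sigma> x. \<bar>h l \<sigma> x\<bar> \<le> c"] by blast
  then have C: "\<bar>h l \<sigma> x\<bar> \<le> C l" if "l \<in> block n (Suc p)" for l \<sigma> x
    using that by blast
  define c where "c = (\<Sum>l\<in>block n (Suc p). \<bar>C l\<bar>)"
  have c: "\<bar>h l \<sigma> x\<bar> \<le> c" if "l \<in> block n (Suc p)" for l \<sigma> x
  proof -
    have "\<bar>C l\<bar> \<le> c" unfolding c_def by (rule member_le_sum) (use that in \<open>auto simp: block_def\<close>)
    with C[OF that, of \<sigma> x] show ?thesis by linarith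
  qed
  interpret tilted_system M G "n p" "\<lambda>\<omega> \<sigma>. \<Prod>q = 1..p. Z M G n f q \<omega> \<sigma>" "F n f p" v a
    by (rule sys)
  interpret bt: block_tilt M G "n p" "\<lambda>\<omega> \<sigma>. \<Prod>q = 1..p. Z M G n f q \<omega> \<sigma>" "F n f p" v a k h c
  proof unfold_locales
    fix l assume "l \<in> {n p + 1..n p + k}"
    then have l: "l \<in> block n (Suc p)" by (simp only: blk)
    show "(\<lambda>(\<sigma>, x). h l \<sigma> x) \<in> borel_measurable (overlap_algebra {n p + 1..n p + k} \<Otimes>\<^sub>M borel)"
      using h[OF l] by (simp only: blk bounded_measurable_def)
    show "\<bar>h l \<sigma> x\<bar> \<le> c" for \<sigma> x by (rule c[OF l])
  qed
  have F_Suc: "F n f (Suc p) s \<sigma> = F n f p s \<sigma> + bt.B s \<sigma>" for s and \<sigma> :: "nat \<Rightarrow> 'h"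
    unfolding bt.B_def blk by (simp add: F_def h_def)
  have Z_Suc: "(\<Prod>q = 1..Suc p. Z M G n f q \<omega> \<sigma>) = bt.dens 1 k \<omega> \<sigma>" for \<omega> \<sigma>
  proof -
    have "F_at \<mu> n f (Suc p) l (\<sigma> l) \<sigma> = F n f p (\<sigma> l) \<sigma> + 1 * bt.B_at l \<sigma>"
      if "l \<in> block n (Suc p)" for l
    proof -
      have "h l \<sigma> = f l (block_overlaps n (Suc p) \<sigma>)" by (simp add: h_def fun_eq_iff)
      then show ?thesis
        unfolding bt.B_at_def blk F_at_def F_Suc using that by simp
    qed
    then have "exp (\<Sum>l\<in>block n (Suc p). F_at \<mu> n f (Suc p) l (\<sigma> l) \<sigma>)
        = (\<Prod>l\<in>block n (Suc p). exp (F n f p (\<sigma> l) \<sigma> + 1 * bt.B_at l \<sigma>))"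
      by (subst exp_sum) (auto simp: block_def)
    moreover have "card (block n (Suc p)) = k" by (simp add: block_def k_def)
    ultimately have "Z M G n f (Suc p) \<omega> \<sigma>
        = (\<Prod>l\<in>block n (Suc p). exp (F n f p (\<sigma> l) \<sigma> + 1 * bt.B_at l \<sigma>)) * inverse (bt.Zt 1 \<omega> \<sigma>) ^ k"
      unfolding Z_def bt.Zt_def F_Suc by (simp add: divide_inverse power_inverse)
    then show ?thesis
      unfolding bt.dens_def blk by (simp add: mult.assoc)
  qed
  show "\<exists>v a. tilted_system M G (n (Suc p)) (\<lambda>\<omega> \<sigma>. \<Prod>q = 1..Suc p. Z M G n f q \<omega> \<sigma>) (F n f (Suc p)) v a"
  proof -
    have "(F n f (Suc p) :: 'h \<Rightarrow> (nat \<Rightarrow> 'h) \<Rightarrow> real) = (\<lambda>s \<sigma>. F n f p s \<sigma> + bt.B s \<sigma>)"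
      by (intro ext F_Suc)
    moreover have "(\<lambda>\<omega> \<sigma>. \<Prod>q = 1..Suc p. Z M G n f q \<omega> \<sigma>) = bt.dens 1 k"
      by (intro ext Z_Suc)
    ultimately show ?thesis
      unfolding N[symmetric] using bt.tilted_system_after_block by (auto simp only:)
  qed
  show "E_avg M G (\<lambda>\<omega> \<sigma>. (\<Prod>q = 1..Suc p. Z M G n f q \<omega> \<sigma>) * \<Psi> \<sigma>) = E_avg M G (\<lambda>\<omega> \<sigma>. \<Psi> \<sigma>)"
    if "bounded_measurable (overlap_algebra (block n (Suc p))) \<Psi>"
    unfolding Z_Suc using bt.T_1[OF order_refl, unfolded blk, OF that] by (simp only: bt.T_def)
qed

end

theorem theorem5:
  fixes M :: "'w measure"
    and G :: "'w \<Rightarrow> 'h::{real_inner, complete_space, second_countable_topology} measure"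
    and r :: nat
    and n :: "nat \<Rightarrow> nat"
    and f :: "nat \<Rightarrow> (nat \<times> nat \<Rightarrow> real) \<Rightarrow> real \<Rightarrow> real"
    and \<Phi> :: "(nat \<times> nat \<Rightarrow> real) \<Rightarrow> real"
  assumes "random_measure_on_unit_ball M G"
    and "ghirlanda_guerra M G"
    and "r \<ge> 1"
    and "n 0 = 0"
    and "1 \<le> n 1"
    and "strict_mono_on {1..r} n"
    and "\<And>p l. p \<in> {1..r} \<Longrightarrow> l \<in> block n p \<Longrightarrow>
           bounded_measurable (block_space n p \<Otimes>\<^sub>M borel) (\<lambda>(R, x). f l R x)"
    and "bounded_measurable (block_space n r) \<Phi>"
  shows "E_avg M G (\<lambda>\<omega> \<sigma>. \<Phi> (block_overlaps n r \<sigma>))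
       = E_avg M G (\<lambda>\<omega> \<sigma>. (\<Prod>p = 1..r. Z M G n f p \<omega> \<sigma>) * \<Phi> (block_overlaps n r \<sigma>))"
proof -
  interpret ghirlanda_guerra_measure M G
    by (intro ghirlanda_guerra_measure.intro random_measure.intro ghirlanda_guerra_measure_axioms.intro)
       (use assms(1,2) in \<open>simp_all only: random_measure_on_unit_ball_def\<close>)
  have le: "n p \<le> n (Suc p)" if "Suc p \<le> r" for p
  proof (cases "p = 0")
    case False
    then show ?thesis
      using that strict_mono_onD[OF assms(6), of p "Suc p"] by simp
  qed (simp add: assms(4))
  have sys: "\<exists>v a. tilted_system M G (n p) (\<lambda>\<omega> \<sigma>. \<Prod>q = 1..p. Z M G n f q \<omega> \<sigma>) (F n f p) v a"
    if "p \<le> r" for p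
    using that
  proof (induction p)
    case 0
    have "F n f 0 = (\<lambda>(_::'h) _. 0)" by (intro ext) (simp add: F_def)
    then show ?case using tilted_system_initial by (auto simp: assms(4))
  next
    case (Suc p)
    then obtain v a where "tilted_system M G (n p) (\<lambda>\<omega> \<sigma>. \<Prod>q = 1..p. Z M G n f q \<omega> \<sigma>) (F n f p) v a"
      by auto
    then show ?case
    proof (rule tilted_system_block(1))
      show "n p \<le> n (Suc p)" by (rule le[OF Suc.prems])
      show "bounded_measurable (block_space n (Suc p) \<Otimes>\<^sub>M borel) (\<lambda>(R, x). f l R x)"
        if "l \<in> block n (Suc p)" for l
        by (rule assms(7)) (use that Suc.prems in auto)
    qed
  qed
  obtain p where r: "r = Suc p" using assms(3) by (cases r) auto
  obtain v a where "tilted_system M G (n p) (\<lambda>\<omega> \<sigma>. \<Prod>q = 1..p. Z M G n f q \<omega> \<sigma>) (F n f p) v a"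
    using sys[of p] r by auto
  then show ?thesis
    unfolding r
  proof (rule tilted_system_block(2)[symmetric])
    show "n p \<le> n (Suc p)" using le r by simp
    show "bounded_measurable (block_space n (Suc p) \<Otimes>\<^sub>M borel) (\<lambda>(R, x). f l R x)"
      if "l \<in> block n (Suc p)" for l
      by (rule assms(7)) (use that r in auto)
    show "bounded_measurable (overlap_algebra (block n (Suc p))) (\<lambda>\<sigma>. \<Phi> (block_overlaps n (Suc p) \<sigma>))"
      by (rule bounded_measurable_compose[OF block_overlaps_measurable assms(8)[unfolded r]])
  qed
qed

end
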